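(* Let $d \ge 3$ and $k \ge d+1$ be integers, and let $\alpha$ be a real number with $d+1\le \alpha < 2d+1$. There exist constants $c>0$ (sufficiently large, depending only on $d$) and $c'>0$ such that the following holds. Let $P$ be a set of $n$ points in $\mathbb{R}^d$ for which the number of $k$-rich $(d-1)$-spheres (with respect to $P$) is at least $c\left(n^{d+1}/k^{\alpha} + n/k\right)$. Then there exists a $(d-2)$-sphere in $\mathbb{R}^d$ that contains at least $c'\,k^{(2d+1-\alpha)/d}$ points of $P$.
   Context: A sphere in $\mathbb{R}^d$ is called $k$-rich with respect to a point set $P$ if it contains at least $k$ points of $P$. A $(d-1)$-sphere is a sphere of codimension one in $\mathbb{R}^d$; a $(d-2)$-sphere is a $(d-2)$-dimensional sphere lying in some hyperplane of $\mathbb{R}^d$ (e.g., the intersection of two intersecting, non-tangent $(d-1)$-spheres). The number of $k$-rich $(d-1)$-spheres may be infinite, in which case the hypothesis is satisfied. *)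

theory Defs
  imports "HOL-Analysis.Analysis"
begin

definition hypersphere :: "'a::euclidean_space set \<Rightarrow> bool" where
  "hypersphere S \<longleftrightarrow> (\<exists>c r. r > 0 \<and> S = sphere c r)"

definition codim2_sphere :: "'a::euclidean_space set \<Rightarrow> bool" where
  "codim2_sphere S \<longleftrightarrow>
     (\<exists>c r u. r > 0 \<and> u \<noteq> 0 \<and> S = sphere c r \<inter> {x. u \<bullet> (x - c) = 0})"

definition rich_hyperspheres :: "nat \<Rightarrow> 'a::euclidean_space set \<Rightarrow> 'a set set" where
  "rich_hyperspheres k P = {S. hypersphere S \<and> card (S \<inter> P) \<ge> k}"

end

theory Submission
  imports Defs
begin

text \<open>
Lift the sphere with centre \<open>c\<close> and radius \<open>r\<close> to the point \<open>(c, |c|^2 - r^2)\<close> of a space of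
dimension \<open>D = d + 1\<close>, and a point \<open>p\<close> to the affine functional
\<open>(c, w) \<mapsto> |p|^2 - 2 p \<bullet> c + w\<close>; incidence becomes vanishing. Suppose that every codimension-two
sphere has at most \<open>T\<close> points of \<open>P\<close>, so that two distinct spheres share at most \<open>T\<close> points.

Sample \<open>s\<close> of the \<open>n\<close> functionals and assign to every lifted sphere \<open>x\<close> a simplex-like cell:
start at \<open>x\<close>, shoot a ray from the centre of the current face through the current point to the
boundary of the face, continue on the smaller face reached, and record the centres. By Helly's
theorem the record depends on boundedly many sampled functionals, so Clarkson's backward analysis
shows that on average only \<open>O(n/s)\<close> functionals separate two recorded points. The records number
\<open>O(s^D)\<close>. Hence one cell contains a fraction of order \<open>s^(-D)\<close> of all \<open>x\<close> and is crossed by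
\<open>O(n/s)\<close> functionals. With \<open>s\<close> of order \<open>n T / k^2\<close> a Cauchy-Schwarz count inside this cell shows
that it contains at most \<open>k/(2T)\<close> lifted spheres, so there are
\<open>O((n T / k^2)^D k/T + n/k)\<close> rich spheres. Now let \<open>T\<close> be a small multiple of
\<open>k^((2d+1-\<alpha>)/d)\<close>.
\<close>

section \<open>Faces of an arrangement and ray shooting\<close>

definition aff_val :: "'e::euclidean_space \<times> real \<Rightarrow> 'e \<Rightarrow> real" where
  "aff_val g z = fst g \<bullet> z + snd g"

text \<open>The closed face whose relative interior contains \<open>y\<close>.\<close>

definition face :: "('e::euclidean_space \<times> real) set \<Rightarrow> 'e \<Rightarrow> 'e set" where
  "face R y = {z. \<forall>g\<in>R. (aff_val g y = 0 \<longrightarrow> aff_val g z = 0) \<and> 0 \<le> sgn (aff_val g y) * aff_val g z}"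

definition centre :: "('e::euclidean_space \<times> real) set \<Rightarrow> 'e \<Rightarrow> 'e" where
  "centre R y = closest_point (face R y) 0"

definition is_exit :: "('e::euclidean_space \<times> real) set \<Rightarrow> 'e \<Rightarrow> 'e \<Rightarrow> bool" where
  "is_exit R y y' \<longleftrightarrow> y' \<in> face R y \<and> (\<exists>t\<ge>1. y' = centre R y + t *\<^sub>R (y - centre R y)) \<and>
     (\<exists>g\<in>R. aff_val g y \<noteq> 0 \<and> aff_val g y' = 0)"

definition exit_point :: "('e::euclidean_space \<times> real) set \<Rightarrow> 'e \<Rightarrow> 'e" where
  "exit_point R y = (if y = centre R y then y else (SOME y'. is_exit R y y'))"

lemma aff_val_line: "aff_val g (u + t *\<^sub>R (v - u)) = aff_val g u + t * (aff_val g v - aff_val g u)"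
  by (simp add: aff_val_def algebra_simps)

lemma aff_val_comb: "a + b = 1 \<Longrightarrow> aff_val g (a *\<^sub>R u + b *\<^sub>R v) = a * aff_val g u + b * aff_val g v"
proof -
  assume "a + b = 1"
  then have b: "b = 1 - a" by simp
  show ?thesis unfolding b by (simp add: aff_val_def algebra_simps)
qed

lemma continuous_aff_val [continuous_intros]: "continuous_on A (aff_val g)"
  unfolding aff_val_def by (intro continuous_intros)

lemma face_Int: "face R y = (\<Inter>g\<in>R. face {g} y)"
  by (auto simp: face_def)

lemma face_self [simp]: "y \<in> face R y"
  by (auto simp: face_def sgn_if)

lemma face_antimono: "R \<subseteq> R' \<Longrightarrow> face R' y \<subseteq> face R y"
  by (auto simp: face_def)

lemma face_closed: "closed (face R y)"
proof -
  have "closed (face {g} y)" for g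
  proof -
    have "face {g} y = {z. aff_val g y = 0 \<longrightarrow> aff_val g z = 0} \<inter> {z. 0 \<le> sgn (aff_val g y) * aff_val g z}"
      by (auto simp: face_def)
    moreover have "closed {z. aff_val g y = 0 \<longrightarrow> aff_val g z = 0}"
      by (cases "aff_val g y = 0") (simp_all add: closed_Collect_eq continuous_intros)
    moreover have "closed {z. 0 \<le> sgn (aff_val g y) * aff_val g z}"
      by (intro closed_Collect_le continuous_intros)
    ultimately show ?thesis by (simp add: closed_Int)
  qed
  then show ?thesis by (subst face_Int) auto
qed

lemma face_convex: "convex (face R y)"
proof (rule convexI)
  fix u v :: 'a and a b :: real
  assume u: "u \<in> face R y" and v: "v \<in> face R y" and ab: "0 \<le> a" "0 \<le> b" "a + b = 1"
  show "a *\<^sub>R u + b *\<^sub>R v \<in> face R y"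
    unfolding face_def
  proof (intro CollectI ballI conjI impI)
    fix g assume g: "g \<in> R"
    have c: "aff_val g (a *\<^sub>R u + b *\<^sub>R v) = a * aff_val g u + b * aff_val g v"
      using ab aff_val_comb by blast
    have "0 \<le> sgn (aff_val g y) * aff_val g u" "0 \<le> sgn (aff_val g y) * aff_val g v"
      using u v g by (auto simp: face_def)
    then have "0 \<le> a * (sgn (aff_val g y) * aff_val g u) + b * (sgn (aff_val g y) * aff_val g v)"
      using ab by simp
    then show "0 \<le> sgn (aff_val g y) * aff_val g (a *\<^sub>R u + b *\<^sub>R v)"
      unfolding c by (simp add: algebra_simps)
    assume "aff_val g y = 0"
    then show "aff_val g (a *\<^sub>R u + b *\<^sub>R v) = 0"
      unfolding c using u v g by (auto simp: face_def)
  qed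
qed

lemma face_trans:
  assumes "y' \<in> face R y"
  shows "face R y' \<subseteq> face R y"
proof
  fix z assume z: "z \<in> face R y'"
  show "z \<in> face R y"
    unfolding face_def
  proof (intro CollectI ballI conjI impI)
    fix g assume g: "g \<in> R"
    have 1: "aff_val g y = 0 \<Longrightarrow> aff_val g y' = 0" "0 \<le> sgn (aff_val g y) * aff_val g y'"
      using assms g by (auto simp: face_def)
    have 2: "aff_val g y' = 0 \<Longrightarrow> aff_val g z = 0" "0 \<le> sgn (aff_val g y') * aff_val g z"
      using z g by (auto simp: face_def)
    show "aff_val g y = 0 \<Longrightarrow> aff_val g z = 0" using 1 2 by simp
    show "0 \<le> sgn (aff_val g y) * aff_val g z" using 1 2 by (auto simp: sgn_if split: if_splits)
  qed
qed

lemma face_cong: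
  assumes "\<And>g. g \<in> R \<Longrightarrow> sgn (aff_val g y) = sgn (aff_val g y')"
  shows "face R y = face R y'"
proof -
  have "aff_val g y = 0 \<longleftrightarrow> aff_val g y' = 0" if "g \<in> R" for g
    using assms[OF that] by (metis sgn_0_0)
  then show ?thesis using assms unfolding face_def by auto
qed

lemma centre_in_face [simp]: "centre R y \<in> face R y"
  unfolding centre_def by (rule closest_point_in_set[OF face_closed]) (use face_self in blast)

lemma centre_cong: "face R y = face R y' \<Longrightarrow> centre R y = centre R y'"
  by (simp add: centre_def)

lemma centre_unique:
  "v \<in> face R y \<Longrightarrow> (\<And>z. z \<in> face R y \<Longrightarrow> norm v \<le> norm z) \<Longrightarrow> centre R y = v"
  unfolding centre_def
  by (rule closest_point_unique[symmetric]) (auto simp: face_convex face_closed)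

lemma norm_centre_less:
  "z \<in> face R y \<Longrightarrow> z \<noteq> centre R y \<Longrightarrow> norm (centre R y) < norm z"
  unfolding centre_def
  using closest_point_lt[OF face_convex face_closed, of z R y 0] by simp

lemma helly_basis:
  fixes C :: "'i \<Rightarrow> 'e::euclidean_space set"
  assumes "finite R" "\<And>g. g \<in> R \<Longrightarrow> convex (C g)" "convex B"
    and ne: "(\<Inter>g\<in>R. C g) \<noteq> {}" and emp: "B \<inter> (\<Inter>g\<in>R. C g) = {}"
  shows "\<exists>R0\<subseteq>R. card R0 \<le> DIM('e) \<and> B \<inter> (\<Inter>g\<in>R0. C g) = {}"
proof -
  let ?F = "insert B (C ` R)"
  have "\<exists>G\<subseteq>?F. card G \<le> DIM('e) + 1 \<and> \<Inter>G = {}"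
  proof (cases "card ?F \<ge> DIM('e) + 1")
    case True
    show ?thesis
    proof (rule ccontr)
      assume "\<not> ?thesis"
      then have "\<And>G. G \<subseteq> ?F \<Longrightarrow> card G = DIM('e) + 1 \<Longrightarrow> \<Inter>G \<noteq> {}" by auto
      moreover have "\<forall>S\<in>?F. convex S" using assms(2,3) by auto
      ultimately have "\<Inter>?F \<noteq> {}" using True Helly[of ?F] by blast
      with emp show False by simp
    qed
  next
    case False
    then show ?thesis using emp by (intro exI[of _ ?F]) auto
  qed
  then obtain G where G: "G \<subseteq> ?F" "card G \<le> DIM('e) + 1" "\<Inter>G = {}" by blast
  have "B \<in> G"
  proof (rule ccontr)
    assume "B \<notin> G"
    then have "G \<subseteq> C ` R" using G by auto
    then have "\<Inter>(C ` R) \<subseteq> \<Inter>G" by blast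
    with G ne show False by simp
  qed
  moreover have "finite G" using G assms(1) by (meson finite_imageI finite_insert finite_subset)
  ultimately have c: "card (G - {B}) \<le> DIM('e)" using G by simp
  have "G - {B} \<subseteq> C ` R" using G by auto
  then obtain R0 where R0: "R0 \<subseteq> R" "inj_on C R0" "G - {B} = C ` R0"
    by (meson subset_image_inj)
  have "B \<inter> (\<Inter>g\<in>R0. C g) = \<Inter>G" using R0 \<open>B \<in> G\<close> by (metis Inter_insert insert_Diff)
  moreover have "card R0 \<le> DIM('e)" using c R0 by (metis card_image)
  ultimately show ?thesis using R0(1) G(3) by (intro exI[of _ R0]) simp
qed

lemma convex_cball_minus_extreme:
  fixes v :: "'e::euclidean_space"
  shows "convex ({z. norm z \<le> norm v} - {v})"
proof -
  have "v extreme_point_of cball 0 (norm v)"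
    unfolding extreme_point_of_def
  proof (intro conjI ballI notI)
    show "v \<in> cball 0 (norm v)" by simp
    fix a b :: 'e assume ab: "a \<in> cball 0 (norm v)" "b \<in> cball 0 (norm v)" "v \<in> open_segment a b"
    then have "dist 0 v < dist 0 a \<or> dist 0 v < dist 0 b" by (intro dist_decreases_open_segment)
    with ab show False by auto
  qed
  then have "convex (cball 0 (norm v) - {v})"
    using extreme_point_of_stillconvex[of "cball 0 (norm v)" v] by simp
  moreover have "cball 0 (norm v) = {z::'e. norm z \<le> norm v}" by auto
  ultimately show ?thesis by (simp only:)
qed

lemma centre_basis:
  fixes y :: "'e::euclidean_space"
  assumes "finite R"
  shows "\<exists>B\<subseteq>R. card B \<le> DIM('e) \<and> (\<forall>Q. B \<subseteq> Q \<longrightarrow> Q \<subseteq> R \<longrightarrow> centre Q y = centre R y)"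
proof -
  let ?v = "centre R y"
  let ?B = "{z. norm z \<le> norm ?v} - {?v}"
  have "?B \<inter> (\<Inter>g\<in>R. face {g} y) = {}"
    using norm_centre_less[of _ R y] by (subst face_Int[symmetric]) force
  moreover have "(\<Inter>g\<in>R. face {g} y) \<noteq> {}"
    using face_self[of y R] face_Int[of R y] by blast
  ultimately obtain B where B: "B \<subseteq> R" "card B \<le> DIM('e)" "?B \<inter> (\<Inter>g\<in>B. face {g} y) = {}"
    using helly_basis[OF assms, of "\<lambda>g. face {g} y" ?B, OF face_convex convex_cball_minus_extreme]
    by blast
  have "centre Q y = ?v" if Q: "B \<subseteq> Q" "Q \<subseteq> R" for Q
  proof (rule centre_unique)
    show "?v \<in> face Q y" using face_antimono[OF Q(2)] centre_in_face by blast
    fix z assume "z \<in> face Q y"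
    then have "z \<in> (\<Inter>g\<in>B. face {g} y)" using face_antimono[OF Q(1), of y] face_Int[of B y] by auto
    then have "z \<notin> ?B" using B(3) by blast
    then show "norm ?v \<le> norm z" by auto
  qed
  with B show ?thesis by blast
qed

lemma is_exit_unique:
  assumes "is_exit R y p" "is_exit R y q"
  shows "p = q"
proof -
  let ?v = "centre R y"
  have *: "s \<le> t" if p: "is_exit R y (?v + t *\<^sub>R (y - ?v))" and "1 \<le> t"
      and q: "is_exit R y (?v + s *\<^sub>R (y - ?v))" for s t
  proof (rule ccontr)
    assume "\<not> s \<le> t"
    obtain g where g: "g \<in> R" "aff_val g y \<noteq> 0" "aff_val g (?v + t *\<^sub>R (y - ?v)) = 0"
      using p by (auto simp: is_exit_def)
    define a b \<sigma> where "a = aff_val g ?v" "b = aff_val g y" "\<sigma> = sgn (aff_val g y)"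
    have 1: "a + t * (b - a) = 0" using g by (simp add: aff_val_line a_b_\<sigma>_def)
    have 2: "0 \<le> \<sigma> * (a + s * (b - a))"
      using q g by (simp add: is_exit_def face_def aff_val_line a_b_\<sigma>_def)
    have 3: "0 \<le> \<sigma> * a" using centre_in_face[of R y] g by (simp add: face_def a_b_\<sigma>_def)
    have 4: "\<sigma> * b > 0" using g by (simp add: a_b_\<sigma>_def sgn_if)
    have e: "\<sigma> * a + t * (\<sigma> * b - \<sigma> * a) = 0"
    proof -
      have "\<sigma> * a + t * (\<sigma> * b - \<sigma> * a) = \<sigma> * (a + t * (b - a))" by (simp add: algebra_simps)
      then show ?thesis using 1 by simp
    qed
    have "t * (\<sigma> * b - \<sigma> * a) \<le> 0" using e 3 by linarith
    then have "\<sigma> * b - \<sigma> * a \<le> 0" using \<open>1 \<le> t\<close> by (smt (verit) mult_pos_pos)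
    moreover have "\<sigma> * b - \<sigma> * a \<noteq> 0" using e 4 by auto
    ultimately have "\<sigma> * b - \<sigma> * a < 0" by linarith
    then have "(s - t) * (\<sigma> * b - \<sigma> * a) < 0" using \<open>\<not> s \<le> t\<close> by (intro mult_pos_neg) auto
    moreover have "0 \<le> \<sigma> * a + s * (\<sigma> * b - \<sigma> * a)" using 2 by (simp add: algebra_simps)
    ultimately show False using e by (simp add: algebra_simps)
  qed
  obtain t where t: "1 \<le> t" "p = ?v + t *\<^sub>R (y - ?v)" using assms by (auto simp: is_exit_def)
  obtain s where s: "1 \<le> s" "q = ?v + s *\<^sub>R (y - ?v)" using assms by (auto simp: is_exit_def)
  have "s = t" using *[of t s] *[of s t] s t assms by force
  then show ?thesis using s t by simp
qed

text \<open>The exit point is the last point of the ray inside the face; if no new functional vanished there, the ray could be prolonged.\<close>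

lemma is_exit_exists:
  fixes y :: "'e::euclidean_space"
  assumes "finite R" and bd: "bounded (face R y)" and ne: "y \<noteq> centre R y"
  shows "\<exists>y'. is_exit R y y'"
proof -
  let ?v = "centre R y"
  define f where "f t = ?v + t *\<^sub>R (y - ?v)" for t :: real
  define S where "S = {t. f t \<in> face R y}"
  have cf: "continuous_on A f" for A unfolding f_def by (intro continuous_intros)
  have "closed S" unfolding S_def
    using continuous_closed_vimage[OF face_closed[of R y], of f] cf[of UNIV]
    by (simp add: vimage_def continuous_on_eq_continuous_at)
  moreover have "bounded S"
  proof -
    obtain M where M: "\<And>z. z \<in> face R y \<Longrightarrow> norm z \<le> M" using bd by (auto simp: bounded_iff)
    have "norm t \<le> (M + norm ?v) / norm (y - ?v)" if "t \<in> S" for t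
    proof -
      have "\<bar>t\<bar> * norm (y - ?v) = norm (f t - ?v)" by (simp add: f_def)
      also have "\<dots> \<le> M + norm ?v" using M[of "f t"] that norm_triangle_ineq4[of "f t" ?v] by (simp add: S_def)
      finally show ?thesis using ne by (simp add: field_simps)
    qed
    then show ?thesis by (auto simp: bounded_iff)
  qed
  moreover have "1 \<in> S" by (simp add: S_def f_def)
  ultimately obtain T where T: "T \<in> S" "\<And>t. t \<in> S \<Longrightarrow> t \<le> T"
    using compact_attains_sup[of S] by (auto simp: compact_eq_bounded_closed)
  have "1 \<le> T" using T \<open>1 \<in> S\<close> by blast
  moreover have "f T \<in> face R y" using T by (simp add: S_def)
  moreover have "\<exists>g\<in>R. aff_val g y \<noteq> 0 \<and> aff_val g (f T) = 0"
  proof (rule ccontr)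
    assume "\<not> ?thesis"
    then have nz: "\<And>g. g \<in> R \<Longrightarrow> aff_val g y \<noteq> 0 \<Longrightarrow> aff_val g (f T) \<noteq> 0" by blast
    have "\<forall>\<^sub>F t in at T. f t \<in> face {g} y" if g: "g \<in> R" for g
    proof (cases "aff_val g y = 0")
      case True
      then have "aff_val g ?v = 0" using centre_in_face[of R y] g by (simp add: face_def)
      with True have "aff_val g (f t) = 0" for t by (simp add: f_def aff_val_line)
      with True show ?thesis by (simp add: face_def)
    next
      case False
      have "0 \<le> sgn (aff_val g y) * aff_val g (f T)"
        using \<open>f T \<in> face R y\<close> g by (simp add: face_def)
      moreover have "sgn (aff_val g y) * aff_val g (f T) \<noteq> 0"
        using nz[OF g False] False by (simp add: sgn_0_0)
      ultimately have pos: "0 < sgn (aff_val g y) * aff_val g (f T)" by linarith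
      have "continuous (at T) (\<lambda>t. sgn (aff_val g y) * aff_val g (f t))"
        unfolding f_def aff_val_def by (intro continuous_intros)
      then have "((\<lambda>t. sgn (aff_val g y) * aff_val g (f t)) \<longlongrightarrow> sgn (aff_val g y) * aff_val g (f T)) (at T)"
        by (simp add: continuous_at)
      then have "\<forall>\<^sub>F t in at T. 0 < sgn (aff_val g y) * aff_val g (f t)"
        using pos order_tendstoD(1) by blast
      then show ?thesis
        by eventually_elim (use False in \<open>auto simp: face_def\<close>)
    qed
    then have "\<forall>\<^sub>F t in at T. \<forall>g\<in>R. f t \<in> face {g} y"
      using assms(1) by (simp add: eventually_ball_finite)
    then have "\<forall>\<^sub>F t in at T. t \<in> S"
      by eventually_elim (subst S_def, subst face_Int, auto)
    then have "\<forall>\<^sub>F t in at_right T. t \<in> S"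
      by (simp add: eventually_at_split)
    then obtain b where "b > T" "\<forall>z>T. z < b \<longrightarrow> z \<in> S"
      by (auto simp: eventually_at_right_field)
    then have "(T + b) / 2 \<in> S" "(T + b) / 2 > T" by auto
    then show False using T by force
  qed
  ultimately show ?thesis unfolding is_exit_def f_def by blast
qed

definition walk :: "('e::euclidean_space \<times> real) set \<Rightarrow> 'e \<Rightarrow> nat \<Rightarrow> 'e" where
  "walk R x j = (exit_point R ^^ j) x"

text \<open>Each exit lowers the dimension of the face, so the walk has become stationary after \<open>DIM('e)\<close> steps.\<close>

definition cell_vertices :: "('e::euclidean_space \<times> real) set \<Rightarrow> 'e \<Rightarrow> 'e set" where
  "cell_vertices R x = (\<lambda>j. centre R (walk R x j)) ` {..DIM('e)}"

lemma walk_0 [simp]: "walk R x 0 = x"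
  and walk_Suc: "walk R x (Suc j) = exit_point R (walk R x j)"
  by (simp_all add: walk_def)

lemma exit_point_eqI: "is_exit R y y' \<Longrightarrow> y \<noteq> centre R y \<Longrightarrow> exit_point R y = y'"
  unfolding exit_point_def by (auto intro: some_equality dest: is_exit_unique)

lemma is_exit_exit_point:
  assumes "finite R" "bounded (face R y)" "y \<noteq> centre R y"
  shows "is_exit R y (exit_point R y)"
proof -
  obtain y' where "is_exit R y y'" using is_exit_exists[OF assms] by blast
  with exit_point_eqI[OF this assms(3)] show ?thesis by simp
qed

lemma exit_point_in_face:
  assumes "finite R" "bounded (face R y)"
  shows "exit_point R y \<in> face R y"
proof (cases "y = centre R y")
  case True
  then have "exit_point R y = y" by (simp add: exit_point_def)
  then show ?thesis by simp
next
  case False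
  then show ?thesis using is_exit_exit_point[OF assms] by (simp add: is_exit_def)
qed

lemma walk_in_face_0:
  assumes "finite R" "bounded (face R x)"
  shows "walk R x j \<in> face R x"
proof (induction j)
  case (Suc j)
  have "bounded (face R (walk R x j))"
    by (rule bounded_subset[OF assms(2) face_trans[OF Suc]])
  from exit_point_in_face[OF assms(1) this] show ?case
    using face_trans[OF Suc] by (auto simp: walk_Suc)
qed simp

lemma walk_bounded:
  assumes "finite R" "bounded (face R x)"
  shows "bounded (face R (walk R x j))"
  by (rule bounded_subset[OF assms(2) face_trans[OF walk_in_face_0[OF assms]]])

lemma walk_in_face:
  assumes "finite R" "bounded (face R x)" "i \<le> j"
  shows "walk R x j \<in> face R (walk R x i)"
  using \<open>i \<le> j\<close>
proof (induction j rule: dec_induct)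
  case base
  show ?case by simp
next
  case (step j)
  from exit_point_in_face[OF assms(1) walk_bounded[OF assms(1,2), of j]] show ?case
    using face_trans[OF step.IH] by (auto simp: walk_Suc)
qed

lemma aff_dim_flat_less:
  assumes "is_exit R y y'"
  defines "A \<equiv> \<lambda>y. {z. \<forall>g\<in>R. aff_val g y = 0 \<longrightarrow> aff_val g z = 0}"
  shows "aff_dim (A y') < aff_dim (A y)"
proof -
  have aff: "affine (A u)" for u
    unfolding affine_def A_def by (auto simp: aff_val_comb)
  have "y' \<in> face R y" using assms by (simp add: is_exit_def)
  then have "A y' \<subseteq> A y" unfolding A_def face_def by blast
  moreover have "y \<in> A y" by (simp add: A_def)
  moreover have "y \<notin> A y'" using assms(1) unfolding A_def is_exit_def by blast
  ultimately have "A y' \<subset> A y" by blast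
  then show ?thesis
    using aff_dim_psubset[of "A y'" "A y"] aff by (simp add: hull_same)
qed

lemma walk_last:
  fixes x :: "'e::euclidean_space"
  assumes "finite R" "bounded (face R x)"
  shows "centre R (walk R x DIM('e)) = walk R x DIM('e)"
proof -
  define A where "A y = {z. \<forall>g\<in>R. aff_val g y = 0 \<longrightarrow> aff_val g z = 0}" for y :: 'e
  have stay: "walk R x (Suc j) = walk R x j" if "centre R (walk R x j) = walk R x j" for j
    using that by (simp add: walk_Suc exit_point_def)
  have "centre R (walk R x j) = walk R x j \<or> aff_dim (A (walk R x j)) \<le> int DIM('e) - int j" for j
  proof (induction j)
    case 0
    show ?case by (simp add: aff_dim_le_DIM)
  next
    case (Suc j)
    show ?case
    proof (cases "centre R (walk R x j) = walk R x j")
      case True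
      then show ?thesis using stay[OF True] by simp
    next
      case False
      then have "is_exit R (walk R x j) (walk R x (Suc j))"
        using is_exit_exit_point[OF assms(1) walk_bounded[OF assms]] by (metis walk_Suc)
      then have "aff_dim (A (walk R x (Suc j))) < aff_dim (A (walk R x j))"
        using aff_dim_flat_less unfolding A_def by blast
      then show ?thesis using Suc False by simp
    qed
  qed
  from this[of "DIM('e)"] show ?thesis
  proof
    let ?y = "walk R x DIM('e)"
    assume "aff_dim (A ?y) \<le> int DIM('e) - int DIM('e)"
    then have "aff_dim (A ?y) \<le> 0" by simp
    moreover have y: "?y \<in> A ?y" by (simp add: A_def)
    ultimately have "aff_dim (A ?y) = 0"
      by (smt (verit) aff_dim_negative_iff empty_iff)
    then obtain a where a: "A ?y = {a}" by (auto simp: aff_dim_eq_0)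
    moreover have "centre R ?y \<in> A ?y" using centre_in_face[of R ?y] by (simp add: A_def face_def)
    ultimately show ?thesis using y by simp
  qed
qed

lemma exit_point_local:
  fixes y :: "'e::euclidean_space"
  assumes "finite R" "bounded (face R y)"
  shows "\<exists>B\<subseteq>R. card B \<le> DIM('e) + 1 \<and>
    (\<forall>Q. B \<subseteq> Q \<longrightarrow> Q \<subseteq> R \<longrightarrow> centre Q y = centre R y \<and> exit_point Q y = exit_point R y)"
proof -
  obtain B where B: "B \<subseteq> R" "card B \<le> DIM('e)" "\<And>Q. B \<subseteq> Q \<Longrightarrow> Q \<subseteq> R \<Longrightarrow> centre Q y = centre R y"
    using centre_basis[OF assms(1), of y] by blast
  show ?thesis
  proof (cases "y = centre R y")
    case True
    have "exit_point Q y = y" if "centre Q y = centre R y" for Q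
    proof -
      have "centre Q y = y" using that True by metis
      then show ?thesis by (simp add: exit_point_def)
    qed
    then have "centre Q y = centre R y \<and> exit_point Q y = exit_point R y" if "B \<subseteq> Q" "Q \<subseteq> R" for Q
      using B(3)[OF that] by simp
    moreover have "card B \<le> DIM('e) + 1" using B(2) by simp
    ultimately show ?thesis using B(1) by blast
  next
    case False
    let ?y' = "exit_point R y"
    have ex: "is_exit R y ?y'" using is_exit_exit_point[OF assms False] .
    then obtain g where g: "g \<in> R" "aff_val g y \<noteq> 0" "aff_val g ?y' = 0"
      unfolding is_exit_def by blast
    have "exit_point Q y = ?y'" if Q: "insert g B \<subseteq> Q" "Q \<subseteq> R" for Q
    proof (rule exit_point_eqI)
      have c: "centre Q y = centre R y" by (rule B(3)) (use Q in auto)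
      show "y \<noteq> centre Q y" unfolding c by (rule False)
      show "is_exit Q y ?y'"
        using ex g Q face_antimono[OF Q(2), of y] unfolding is_exit_def c by blast
    qed
    moreover have "card (insert g B) \<le> DIM('e) + 1"
      using B(2) card_insert_le_m1[of "DIM('e) + 1" B g] by simp
    moreover have "centre Q y = centre R y" if Q: "insert g B \<subseteq> Q" "Q \<subseteq> R" for Q
      by (rule B(3)) (use Q in auto)
    moreover have "insert g B \<subseteq> R" using B(1) g by simp
    ultimately show ?thesis by blast
  qed
qed

lemma cell_vertices_local:
  fixes x :: "'e::euclidean_space"
  assumes "finite R" "bounded (face R x)"
  shows "\<exists>B\<subseteq>R. card B \<le> (DIM('e) + 1)\<^sup>2 \<and>
    (\<forall>Q. B \<subseteq> Q \<longrightarrow> Q \<subseteq> R \<longrightarrow> cell_vertices Q x = cell_vertices R x)"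
proof -
  define w where "w = walk R x"
  have "\<exists>B\<subseteq>R. card B \<le> DIM('e) + 1 \<and>
    (\<forall>Q. B \<subseteq> Q \<longrightarrow> Q \<subseteq> R \<longrightarrow> centre Q (w j) = centre R (w j) \<and> exit_point Q (w j) = exit_point R (w j))" for j
    unfolding w_def using exit_point_local[OF assms(1) walk_bounded[OF assms]] .
  then obtain B where B: "\<And>j. B j \<subseteq> R" "\<And>j. card (B j) \<le> DIM('e) + 1"
    "\<And>j Q. B j \<subseteq> Q \<Longrightarrow> Q \<subseteq> R \<Longrightarrow> centre Q (w j) = centre R (w j) \<and> exit_point Q (w j) = exit_point R (w j)"
    by metis
  let ?B = "\<Union>j\<in>{..DIM('e)}. B j"
  have "card ?B \<le> (\<Sum>j\<in>{..DIM('e)}. card (B j))" by (intro card_UN_le) simp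
  also have "\<dots> \<le> (\<Sum>j\<in>{..DIM('e)}. DIM('e) + 1)" by (intro sum_mono B)
  finally have "card ?B \<le> (DIM('e) + 1)\<^sup>2" by (simp add: power2_eq_square)
  moreover have "cell_vertices Q x = cell_vertices R x" if Q: "?B \<subseteq> Q" "Q \<subseteq> R" for Q
  proof -
    have BQ: "B j \<subseteq> Q" if "j \<le> DIM('e)" for j
      using Q that by blast
    have *: "walk Q x j = w j" if "j \<le> DIM('e)" for j
      using that
    proof (induction j)
      case (Suc j)
      then show ?case using B(3)[of j Q, OF BQ Q(2)] by (simp add: walk_Suc w_def)
    qed (simp add: w_def)
    have "centre Q (walk Q x j) = centre R (walk R x j)" if "j \<le> DIM('e)" for j
      using *[OF that] B(3)[of j Q, OF BQ[OF that] Q(2)] by (simp add: w_def)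
    then show ?thesis unfolding cell_vertices_def by auto
  qed
  moreover have "?B \<subseteq> R" using B(1) by blast
  ultimately show ?thesis by blast
qed

lemma cell_vertices_subset_face:
  assumes "finite R" "bounded (face R x)"
  shows "cell_vertices R x \<subseteq> face R x"
proof
  fix v assume "v \<in> cell_vertices R x"
  then obtain j where v: "v = centre R (walk R x j)" by (auto simp: cell_vertices_def)
  show "v \<in> face R x"
    unfolding v using face_trans[OF walk_in_face_0[OF assms]] centre_in_face by blast
qed

lemma cell_vertices_not_separated:
  assumes "finite R" "bounded (face R x)" "g \<in> R" "u \<in> cell_vertices R x" "v \<in> cell_vertices R x"
  shows "\<not> (aff_val g u < 0 \<and> 0 < aff_val g v)"
proof -
  have "u \<in> face R x" "v \<in> face R x" using cell_vertices_subset_face[OF assms(1,2)] assms by auto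
  then have "aff_val g x = 0 \<Longrightarrow> aff_val g u = 0" "0 \<le> sgn (aff_val g x) * aff_val g u"
    "0 \<le> sgn (aff_val g x) * aff_val g v"
    using assms(3) by (auto simp: face_def)
  then show ?thesis by (cases "aff_val g x" "0::real" rule: linorder_cases) auto
qed

text \<open>Every walk point lies strictly between its centre and its successor, so \<open>x\<close> is a convex combination with positive weights of the cell vertices.\<close>

lemma walk_nonneg:
  fixes x :: "'e::euclidean_space"
  assumes "finite R" "bounded (face R x)"
    and pos: "\<And>v. v \<in> cell_vertices R x \<Longrightarrow> 0 \<le> aff_val p v"
  shows "0 \<le> aff_val p x"
    and "aff_val p x = 0 \<Longrightarrow> v \<in> cell_vertices R x \<Longrightarrow> aff_val p v = 0"
proof -
  let ?D = "DIM('e)"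
  have c: "0 \<le> aff_val p (centre R (walk R x j))" if "j \<le> ?D" for j
    using that by (intro pos) (auto simp: cell_vertices_def)
  have comb: "\<exists>t\<ge>1. aff_val p (walk R x (Suc j)) = aff_val p (centre R (walk R x j)) +
      t * (aff_val p (walk R x j) - aff_val p (centre R (walk R x j)))" for j
  proof (cases "walk R x j = centre R (walk R x j)")
    case True
    then have "walk R x (Suc j) = walk R x j" by (simp add: walk_Suc exit_point_def)
    then show ?thesis using True by (intro exI[of _ 1]) simp
  next
    case False
    then have "is_exit R (walk R x j) (walk R x (Suc j))"
      using is_exit_exit_point[OF assms(1) walk_bounded[OF assms(1,2)]] by (simp add: walk_Suc)
    then show ?thesis unfolding is_exit_def by (metis aff_val_line)
  qed
  have w: "0 \<le> aff_val p (walk R x j)" if "j \<le> ?D" for j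
    using that
  proof (induction rule: inc_induct)
    case base
    show ?case using c[of ?D] walk_last[OF assms(1,2)] by simp
  next
    case (step j)
    define a b where "a = aff_val p (centre R (walk R x j))" "b = aff_val p (walk R x j)"
    obtain t where t: "t \<ge> 1" "0 \<le> a + t * (b - a)" using comb[of j] step by (auto simp: a_b_def)
    have a: "0 \<le> a" using c step by (simp add: a_b_def)
    have "0 \<le> b"
    proof (rule ccontr)
      assume "\<not> 0 \<le> b"
      then have "t * (b - a) \<le> 1 * (b - a)" using t a by (intro mult_right_mono_neg) auto
      then show False using t \<open>\<not> 0 \<le> b\<close> by simp
    qed
    then show ?case by (simp add: a_b_def)
  qed
  from w[of 0] show "0 \<le> aff_val p x" by simp
  assume 0: "aff_val p x = 0"
  have step: "aff_val p (centre R (walk R x j)) = 0 \<and> aff_val p (walk R x (Suc j)) = 0"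
    if j: "j < ?D" "aff_val p (walk R x j) = 0" for j
  proof -
    define a where "a = aff_val p (centre R (walk R x j))"
    have a: "0 \<le> a" using c j by (simp add: a_def)
    show ?thesis
    proof (cases "walk R x j = centre R (walk R x j)")
      case True
      then have "walk R x (Suc j) = walk R x j" by (simp add: walk_Suc exit_point_def)
      then show ?thesis using True j by simp
    next
      case False
      then have ex: "is_exit R (walk R x j) (walk R x (Suc j))"
        using is_exit_exit_point[OF assms(1) walk_bounded[OF assms(1,2)]] by (simp add: walk_Suc)
      then obtain s where s: "s \<ge> 1" "walk R x (Suc j) = centre R (walk R x j) + s *\<^sub>R (walk R x j - centre R (walk R x j))"
        unfolding is_exit_def by blast
      have "s \<noteq> 1"
      proof
        assume "s = 1"
        then have "walk R x (Suc j) = walk R x j" using s by simp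
        then show False using ex unfolding is_exit_def by auto
      qed
      then have "s > 1" using s by simp
      have e: "aff_val p (walk R x (Suc j)) = a - s * a" unfolding s(2) aff_val_line using j by (simp add: a_def)
      then have "a * (s - 1) \<le> 0" using w[of "Suc j"] j by (simp add: algebra_simps)
      then have "a = 0" using \<open>s > 1\<close> a by (simp add: mult_le_0_iff)
      then show ?thesis using e by (simp add: a_def)
    qed
  qed
  have "aff_val p (walk R x j) = 0" if "j \<le> ?D" for j
    using that by (induction j) (use 0 step in auto)
  then have "aff_val p (centre R (walk R x j)) = 0" if "j \<le> ?D" for j
    using that step[of j] walk_last[OF assms(1,2)] by (cases "j = ?D") auto
  then show "v \<in> cell_vertices R x \<Longrightarrow> aff_val p v = 0"
    by (auto simp: cell_vertices_def)
qed

lemma incident_imp_separated_or_zero: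
  fixes x :: "'e::euclidean_space"
  assumes "finite R" "bounded (face R x)" "aff_val p x = 0"
    and ns: "\<not> (\<exists>u\<in>cell_vertices R x. \<exists>v\<in>cell_vertices R x. aff_val p u < 0 \<and> 0 < aff_val p v)"
    and "v \<in> cell_vertices R x"
  shows "aff_val p v = 0"
proof (cases "\<exists>u\<in>cell_vertices R x. aff_val p u < 0")
  case False
  then show ?thesis using walk_nonneg(2)[OF assms(1,2) _ assms(3,5)] by force
next
  case True
  have neg: "aff_val (- p) z = - aff_val p z" for z by (simp add: aff_val_def)
  have "\<And>v. v \<in> cell_vertices R x \<Longrightarrow> 0 \<le> aff_val (- p) v" using ns True by (force simp: neg)
  from walk_nonneg(2)[OF assms(1,2) this _ assms(5)] assms(3) show ?thesis by (simp add: neg)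
qed

lemma zero_on_cell_vertices:
  assumes "finite R" "bounded (face R x)" "\<And>v. v \<in> cell_vertices R x \<Longrightarrow> aff_val p v = 0"
  shows "aff_val p x = 0"
proof -
  have neg: "aff_val (- p) z = - aff_val p z" for z by (simp add: aff_val_def)
  have "0 \<le> aff_val p x" by (rule walk_nonneg(1)[OF assms(1,2)]) (simp add: assms(3))
  moreover have "0 \<le> aff_val (- p) x" by (rule walk_nonneg(1)[OF assms(1,2)]) (simp add: assms(3) neg)
  ultimately show ?thesis by (simp add: neg)
qed

section \<open>Counting cells\<close>

definition sign_vector :: "('e::euclidean_space \<times> real) set \<Rightarrow> 'e \<Rightarrow> 'e \<times> real \<Rightarrow> real" where
  "sign_vector G z = (\<lambda>g\<in>G. sgn (aff_val g z))"

lemma sign_vector_eq_iff: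
  "sign_vector G z = sign_vector G z' \<longleftrightarrow> (\<forall>g\<in>G. sgn (aff_val g z) = sgn (aff_val g z'))"
  unfolding sign_vector_def by (auto simp: restrict_def fun_eq_iff)

lemma card_image_le_factor:
  assumes "finite (h ` X)" and fac: "\<And>x x'. x \<in> X \<Longrightarrow> x' \<in> X \<Longrightarrow> h x = h x' \<Longrightarrow> f x = f x'"
  shows "card (f ` X) \<le> card (h ` X)"
proof -
  define k where "k v = f (SOME x. x \<in> X \<and> h x = v)" for v
  have "f x = k (h x)" if "x \<in> X" for x
  proof -
    have "(SOME x'. x' \<in> X \<and> h x' = h x) \<in> X \<and> h (SOME x'. x' \<in> X \<and> h x' = h x) = h x"
      by (rule someI[of _ x]) (simp add: that)
    then show ?thesis unfolding k_def using fac[OF that] by metis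
  qed
  then have "f ` X = k ` (h ` X)" by (auto simp: image_image)
  then show ?thesis using card_image_le[OF assms(1)] by metis
qed

lemma finite_sign_vectors: "finite G \<Longrightarrow> finite (sign_vector G ` A)"
proof -
  assume "finite G"
  then have "finite (PiE G (\<lambda>_. {-1, 0, 1::real}))" by (intro finite_PiE) auto
  moreover have "sign_vector G ` A \<subseteq> PiE G (\<lambda>_. {-1, 0, 1})"
    by (auto simp: sign_vector_def sgn_if split: if_splits)
  ultimately show ?thesis by (rule finite_subset[rotated])
qed

lemma sgn_aff_val_segment:
  assumes "sgn (aff_val g u) = sgn (aff_val g v)" "0 \<le> t" "t \<le> 1"
  shows "sgn (aff_val g (u + t *\<^sub>R (v - u))) = sgn (aff_val g u)"
proof -
  have "aff_val g (u + t *\<^sub>R (v - u)) = (1 - t) * aff_val g u + t * aff_val g v"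
    unfolding aff_val_line by (simp add: algebra_simps)
  moreover have pos: "(1 - t) * a + t * b > 0" if "a > 0" "b > 0" for a b :: real
    using that assms(2,3) by (cases "t = 0") (auto intro: add_nonneg_pos)
  moreover have "(1 - t) * a + t * b < 0" if "a < 0" "b < 0" for a b :: real
    using pos[of "-a" "-b"] that by simp
  moreover have "aff_val g v > 0 \<longleftrightarrow> aff_val g u > 0" "aff_val g v < 0 \<longleftrightarrow> aff_val g u < 0"
    using assms(1) by (auto simp: sgn_if split: if_splits)
  ultimately show ?thesis
    by (cases "aff_val g u" "0::real" rule: linorder_cases) auto
qed

lemma card_sign_vectors_insert:
  fixes A :: "'e::euclidean_space set"
  assumes "finite G" "affine A"
  shows "card (sign_vector (insert g G) ` A)
    \<le> card (sign_vector G ` A) + 2 * card (sign_vector G ` (A \<inter> {z. aff_val g z = 0}))"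
proof -
  define T where "T s = sign_vector G ` (A \<inter> {z. sgn (aff_val g z) = s})" for s
  have fT: "finite (T s)" for s unfolding T_def by (rule finite_sign_vectors[OF assms(1)])
  have "sign_vector (insert g G) z = (sign_vector G z)(g := sgn (aff_val g z))" for z
    by (auto simp: sign_vector_def fun_eq_iff)
  then have "sign_vector (insert g G) ` A \<subseteq>
      (\<lambda>\<sigma>. \<sigma>(g := -1)) ` T (-1) \<union> (\<lambda>\<sigma>. \<sigma>(g := 0)) ` T 0 \<union> (\<lambda>\<sigma>. \<sigma>(g := 1)) ` T 1"
    unfolding T_def by (force simp: sgn_if)
  then have "card (sign_vector (insert g G) ` A) \<le> card ((\<lambda>\<sigma>. \<sigma>(g := -1)) ` T (-1) \<union>
      (\<lambda>\<sigma>. \<sigma>(g := 0)) ` T 0 \<union> (\<lambda>\<sigma>. \<sigma>(g := 1)) ` T 1)"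
    by (intro card_mono) (auto simp: fT)
  also have "\<dots> \<le> card (T (-1)) + card (T 0) + card (T 1)"
    by (intro order_trans[OF card_Un_le] add_mono card_image_le fT)
  also have "\<dots> = card (T (-1) \<union> T 1) + card (T (-1) \<inter> T 1) + card (T 0)"
    using card_Un_Int[OF fT[of "-1"] fT[of 1]] by simp
  also have "\<dots> \<le> card (sign_vector G ` A) + card (T 0) + card (T 0)"
  proof (intro add_mono card_mono finite_sign_vectors[OF assms(1)] fT order_refl)
    show "T (-1) \<union> T 1 \<subseteq> sign_vector G ` A" by (auto simp: T_def)
    show "T (-1) \<inter> T 1 \<subseteq> T 0"
    proof
      fix \<sigma> assume "\<sigma> \<in> T (-1) \<inter> T 1"
      then obtain u v where u: "u \<in> A" "sgn (aff_val g u) = -1" "\<sigma> = sign_vector G u"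
        and v: "v \<in> A" "sgn (aff_val g v) = 1" "\<sigma> = sign_vector G v"
        unfolding T_def by blast
      define a b t where "a = aff_val g u" "b = aff_val g v" "t = a / (a - b)"
      have ab: "a < 0" "b > 0" using u v by (auto simp: a_b_t_def sgn_if split: if_splits)
      have t: "0 \<le> t" "t \<le> 1" using ab by (auto simp: a_b_t_def(3) divide_simps)
      let ?z = "u + t *\<^sub>R (v - u)"
      have "aff_val g ?z = a + t * (b - a)" by (simp add: aff_val_line a_b_t_def)
      also have "\<dots> = 0" using ab by (simp add: a_b_t_def(3) divide_simps) (simp add: algebra_simps)
      finally have "aff_val g ?z = 0" .
      moreover have "?z = (1 - t) *\<^sub>R u + t *\<^sub>R v" by (simp add: algebra_simps)
      then have "?z \<in> A" using assms(2) u(1) v(1) unfolding affine_def by simp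
      moreover have "sign_vector G ?z = \<sigma>"
        unfolding u(3) sign_vector_eq_iff
        using u(3) v(3) t by (auto intro!: sgn_aff_val_segment simp: sign_vector_eq_iff)
      ultimately show "\<sigma> \<in> T 0" unfolding T_def by force
    qed
  qed
  also have "T 0 = sign_vector G ` (A \<inter> {z. aff_val g z = 0})"
    by (simp add: T_def sgn_0_0)
  finally show ?thesis by simp
qed

lemma card_sign_vectors_affine:
  fixes A :: "'e::euclidean_space set"
  assumes "finite G" "affine A" "A \<noteq> {}"
  shows "card (sign_vector G ` A) \<le> (2 * card G + 1) ^ nat (aff_dim A)"
  using assms
proof (induction G arbitrary: A rule: finite_induct)
  case empty
  have "sign_vector {} ` A \<subseteq> {\<lambda>_. undefined}" by (auto simp: sign_vector_def)
  from card_mono[OF _ this] have "card (sign_vector {} ` A) \<le> 1" by simp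
  then show ?case by simp
next
  case (insert g G)
  let ?A0 = "A \<inter> {z. aff_val g z = 0}"
  let ?N = "2 * card G + 1"
  have IH: "card (sign_vector G ` A) \<le> ?N ^ nat (aff_dim A)" using insert by simp
  have mono: "?N ^ nat (aff_dim A) \<le> (2 * card (insert g G) + 1) ^ nat (aff_dim A)"
    using insert by (intro power_mono) auto
  have aff0: "affine {z. aff_val g z = 0}"
    unfolding affine_def by (auto simp: aff_val_comb)
  show ?case
  proof (cases "?A0 = A \<or> ?A0 = {}")
    case True
    then have "card (sign_vector (insert g G) ` A) \<le> card (sign_vector G ` A)"
    proof
      assume A: "?A0 = A"
      have "aff_val g z = 0" if "z \<in> A" for z using A that by blast
      then show ?thesis
        by (intro card_image_le_factor finite_sign_vectors insert.hyps(1)) (auto simp: sign_vector_eq_iff)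
    next
      assume "?A0 = {}"
      then have "card (sign_vector G ` ?A0) = 0" by (metis card.empty image_empty)
      then show ?thesis using card_sign_vectors_insert[OF insert.hyps(1) insert.prems(1), of g] by linarith
    qed
    then show ?thesis using IH mono by linarith
  next
    case False
    have "?A0 \<subset> A" using False by blast
    moreover have a0: "affine ?A0" using insert.prems(1) aff0 by (rule affine_Int)
    ultimately have less: "aff_dim ?A0 < aff_dim A"
      using aff_dim_psubset[of ?A0 A] insert.prems(1) by (simp add: hull_same)
    have "aff_dim ?A0 \<ge> 0" using False by (metis aff_dim_negative_iff linorder_not_less)
    with less obtain m where m: "nat (aff_dim A) = Suc m" "nat (aff_dim ?A0) \<le> m"
      by (intro that[of "nat (aff_dim A) - 1"]) auto
    have "card (sign_vector G ` ?A0) \<le> ?N ^ nat (aff_dim ?A0)"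
      using insert.IH[OF a0] False by blast
    also have "\<dots> \<le> ?N ^ m" using m by (intro power_increasing) auto
    finally have 0: "card (sign_vector G ` ?A0) \<le> ?N ^ m" .
    have "card (sign_vector (insert g G) ` A) \<le> ?N ^ Suc m + 2 * ?N ^ m"
      using card_sign_vectors_insert[OF insert.hyps(1) insert.prems(1), of g] 0 IH m by simp
    also have "\<dots> = (?N + 2) * ?N ^ m" by (simp add: algebra_simps)
    also have "\<dots> \<le> (?N + 2) * (?N + 2) ^ m" by (intro mult_left_mono power_mono) auto
    also have "\<dots> = (2 * card (insert g G) + 1) ^ nat (aff_dim A)"
      using insert m by simp
    finally show ?thesis .
  qed
qed

lemma card_sign_vectors:
  fixes A :: "'e::euclidean_space set"
  assumes "finite G"
  shows "card (sign_vector G ` A) \<le> (2 * card G + 1) ^ DIM('e)"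
proof -
  have "card (sign_vector G ` A) \<le> card (sign_vector G ` UNIV)"
    by (intro card_mono finite_sign_vectors[OF assms]) auto
  also have "\<dots> \<le> (2 * card G + 1) ^ nat (aff_dim (UNIV :: 'e set))"
    by (rule card_sign_vectors_affine[OF assms]) auto
  finally show ?thesis by simp
qed

lemma nested_sign_threshold:
  fixes a :: "nat \<Rightarrow> real"
  assumes "0 < \<epsilon>" "\<epsilon> \<le> 1" "real (D + 1) * M * \<epsilon> < \<mu>" "j \<le> D"
    and bound: "\<And>i. i \<le> D \<Longrightarrow> \<bar>a i\<bar> \<le> M" "\<And>i. i \<le> D \<Longrightarrow> a i \<noteq> 0 \<Longrightarrow> \<mu> \<le> \<bar>a i\<bar>"
    and nested: "\<And>i i'. i \<le> i' \<Longrightarrow> i' \<le> D \<Longrightarrow> a i' \<noteq> 0 \<Longrightarrow> sgn (a i) = sgn (a i')"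
  defines "\<phi> \<equiv> (\<Sum>i\<le>D. \<epsilon> ^ (D - i) * a i)"
  shows "0 < a j \<longleftrightarrow> \<epsilon> ^ (D - j) * \<mu> \<le> \<phi>" and "a j < 0 \<longleftrightarrow> \<phi> \<le> - (\<epsilon> ^ (D - j) * \<mu>)"
proof -
  have M: "0 \<le> M" using bound(1)[of 0] by simp
  then have "0 < \<mu>" using assms(1,3) by (smt (verit) mult_nonneg_nonneg of_nat_0_le_iff)
  then have \<theta>: "0 < \<epsilon> ^ (D - j) * \<mu>" using assms by simp
  have big: "\<epsilon> ^ (D - j) * \<mu> \<le> sgn (a j) * \<phi>" if nz: "a j \<noteq> 0"
  proof -
    have s: "0 \<le> sgn (a j) * a i" if "i \<le> D" for i
    proof (cases "a i = 0")
      case False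
      have "sgn (a i) = sgn (a j)"
        using nested[of i j, OF _ \<open>j \<le> D\<close> nz] nested[of j i, OF _ that False] by linarith
      then show ?thesis using abs_sgn[of "a i"] by (simp add: mult.commute)
    qed simp
    have "\<epsilon> ^ (D - j) * \<mu> \<le> \<epsilon> ^ (D - j) * (sgn (a j) * a j)"
      using bound(2)[OF \<open>j \<le> D\<close> nz] assms(1) by (intro mult_left_mono) (auto simp: abs_sgn mult.commute)
    also have "\<dots> \<le> (\<Sum>i\<le>D. \<epsilon> ^ (D - i) * (sgn (a j) * a i))"
      using s assms(1) \<open>j \<le> D\<close> by (intro member_le_sum[of j _ "\<lambda>i. \<epsilon> ^ (D - i) * (sgn (a j) * a i)"]) auto
    also have "\<dots> = sgn (a j) * \<phi>" by (simp add: \<phi>_def sum_distrib_left algebra_simps)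
    finally show ?thesis .
  qed
  have small: "\<bar>\<phi>\<bar> < \<epsilon> ^ (D - j) * \<mu>" if z: "a j = 0"
  proof -
    have "\<bar>\<epsilon> ^ (D - i) * a i\<bar> \<le> \<epsilon> ^ (D - j) * (\<epsilon> * M)" if i: "i \<le> D" for i
    proof (cases "i < j")
      case True
      then have "\<epsilon> ^ (D - i) \<le> \<epsilon> ^ Suc (D - j)"
        using assms(1,2) \<open>j \<le> D\<close> by (intro power_decreasing) auto
      then have "\<epsilon> ^ (D - i) * \<bar>a i\<bar> \<le> \<epsilon> ^ Suc (D - j) * M"
        using bound(1)[OF i] assms(1) by (intro mult_mono) auto
      then show ?thesis using assms(1) by (simp add: abs_mult algebra_simps)
    next
      case False
      then have "a i = 0" using nested[of j i] i z by (cases "a i = 0") (auto simp: sgn_0_0 eq_commute[of 0])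
      then show ?thesis using assms(1) M by simp
    qed
    then have "(\<Sum>i\<le>D. \<bar>\<epsilon> ^ (D - i) * a i\<bar>) \<le> (\<Sum>i\<le>D. \<epsilon> ^ (D - j) * (\<epsilon> * M))"
      by (intro sum_mono) auto
    then have "\<bar>\<phi>\<bar> \<le> (\<Sum>i\<le>D. \<epsilon> ^ (D - j) * (\<epsilon> * M))"
      unfolding \<phi>_def using sum_abs[of "\<lambda>i. \<epsilon> ^ (D - i) * a i" "{..D}"] by linarith
    also have "\<dots> = \<epsilon> ^ (D - j) * (real (D + 1) * M * \<epsilon>)" by simp
    also have "\<dots> < \<epsilon> ^ (D - j) * \<mu>" using assms(1,3) by (intro mult_strict_left_mono) auto
    finally show ?thesis .
  qed
  show "0 < a j \<longleftrightarrow> \<epsilon> ^ (D - j) * \<mu> \<le> \<phi>"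
    using big small \<theta> by (cases "a j" "0::real" rule: linorder_cases) auto
  show "a j < 0 \<longleftrightarrow> \<phi> \<le> - (\<epsilon> ^ (D - j) * \<mu>)"
    using big small \<theta> by (cases "a j" "0::real" rule: linorder_cases) auto
qed

text \<open>A chain of faces is encoded by the single point \<open>w\<close>, the weighted mean of the \<open>y x i\<close> with weights \<open>\<epsilon> ^ (D - i)\<close>: the order of magnitude of a functional at \<open>w\<close> reveals on which faces of the chain it vanishes. So the sign vector of \<open>w\<close> with respect to all functionals shifted by the thresholds \<open>\<plusminus> \<epsilon> ^ (D - j) * \<mu>\<close> determines the chain.\<close>

lemma card_sign_chains:
  fixes y :: "'x \<Rightarrow> nat \<Rightarrow> 'e::euclidean_space"
  assumes "finite X" "finite R"
    and nested: "\<And>x g i j. x \<in> X \<Longrightarrow> g \<in> R \<Longrightarrow> i \<le> j \<Longrightarrow> j \<le> D \<Longrightarrow> aff_val g (y x j) \<noteq> 0 \<Longrightarrow>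
      sgn (aff_val g (y x i)) = sgn (aff_val g (y x j))"
  shows "card ((\<lambda>x. \<lambda>j\<in>{..D}. sign_vector R (y x j)) ` X) \<le> (4 * (D + 1) * card R + 1) ^ DIM('e)"
proof -
  define V where "V = (\<lambda>(x, g, j). \<bar>aff_val g (y x j)\<bar>) ` (X \<times> R \<times> {..D})"
  have fV: "finite V" unfolding V_def using assms by simp
  have VI: "\<bar>aff_val g (y x j)\<bar> \<in> V" if "x \<in> X" "g \<in> R" "j \<le> D" for x g j
    unfolding V_def using that by (intro image_eqI[of _ _ "(x, g, j)"]) auto
  define M where "M = Max (insert 0 V)"
  define \<mu> where "\<mu> = Min (insert 1 (V - {0}))"
  have M: "\<bar>aff_val g (y x j)\<bar> \<le> M" if "x \<in> X" "g \<in> R" "j \<le> D" for x g j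
    unfolding M_def using fV VI[OF that] by (intro Max_ge) auto
  have \<mu>: "\<mu> \<le> \<bar>aff_val g (y x j)\<bar>" if "x \<in> X" "g \<in> R" "j \<le> D" "aff_val g (y x j) \<noteq> 0" for x g j
    unfolding \<mu>_def using fV VI[OF that(1-3)] that(4) by (intro Min_le) auto
  have "\<mu> \<in> insert 1 (V - {0})" unfolding \<mu>_def using fV by (intro Min_in) auto
  then have \<mu>0: "0 < \<mu>" by (auto simp: V_def)
  have M0: "0 \<le> M" unfolding M_def using fV by (intro Max_ge) auto
  define \<epsilon> where "\<epsilon> = min 1 (\<mu> / (real (D + 1) * M + 1))"
  have p: "0 < real (D + 1) * M + 1" using M0 by (simp add: add_nonneg_pos)
  have \<epsilon>: "0 < \<epsilon>" "\<epsilon> \<le> 1" using \<mu>0 p by (auto simp: \<epsilon>_def)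
  have "\<epsilon> \<le> \<mu> / (real (D + 1) * M + 1)" by (simp add: \<epsilon>_def)
  then have "\<epsilon> * (real (D + 1) * M + 1) \<le> \<mu>" using p by (simp add: pos_le_divide_eq)
  then have \<epsilon>\<mu>: "real (D + 1) * M * \<epsilon> < \<mu>" using \<epsilon>(1) by (simp add: algebra_simps)
  define W where "W = (\<Sum>i\<le>D. \<epsilon> ^ (D - i))"
  have W: "0 < W" unfolding W_def using \<epsilon> by (intro sum_pos) auto
  define w where "w x = (1 / W) *\<^sub>R (\<Sum>i\<le>D. \<epsilon> ^ (D - i) *\<^sub>R y x i)" for x
  define \<phi> where "\<phi> x g = (\<Sum>i\<le>D. \<epsilon> ^ (D - i) * aff_val g (y x i))" for x g
  have val_w: "aff_val g (w x) = \<phi> x g / W" for g x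
  proof -
    have "\<phi> x g = (\<Sum>i\<le>D. \<epsilon> ^ (D - i) * (fst g \<bullet> y x i)) + snd g * W"
      by (simp add: \<phi>_def aff_val_def algebra_simps sum.distrib W_def sum_distrib_left)
    moreover have "fst g \<bullet> w x = (\<Sum>i\<le>D. \<epsilon> ^ (D - i) * (fst g \<bullet> y x i)) / W"
      by (simp add: w_def inner_sum_right)
    ultimately show ?thesis using W by (simp add: aff_val_def field_simps)
  qed
  define sh where "sh = (\<lambda>(j, g, s). (fst g, snd g + s * (\<epsilon> ^ (D - j) * \<mu>) / W) :: 'e \<times> real)"
  define G where "G = sh ` ({..D} \<times> R \<times> {-1, 1::real})"
  have val_sh: "aff_val (sh (j, g, s)) (w x) = (\<phi> x g + s * (\<epsilon> ^ (D - j) * \<mu>)) / W" for j g s x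
  proof -
    have "aff_val (sh (j, g, s)) (w x) = aff_val g (w x) + s * (\<epsilon> ^ (D - j) * \<mu>) / W"
      by (simp add: sh_def aff_val_def)
    then show ?thesis by (simp add: val_w add_divide_distrib)
  qed
  have fG: "finite G" using assms(2) by (simp add: G_def)
  have "card G \<le> card ({..D} \<times> R \<times> {-1, 1::real})" unfolding G_def
    by (intro card_image_le) (use assms(2) in auto)
  then have cG: "card G \<le> 2 * (D + 1) * card R" by (simp add: card_cartesian_product algebra_simps)
  have "card ((\<lambda>x. \<lambda>j\<in>{..D}. sign_vector R (y x j)) ` X) \<le> card ((\<lambda>x. sign_vector G (w x)) ` X)"
  proof (rule card_image_le_factor)
    show "finite ((\<lambda>x. sign_vector G (w x)) ` X)" using assms(1) by simp
    fix x x' assume x: "x \<in> X" "x' \<in> X" and eq: "sign_vector G (w x) = sign_vector G (w x')"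
    have "sgn (aff_val g (y x j)) = sgn (aff_val g (y x' j))" if g: "g \<in> R" and j: "j \<le> D" for g j
    proof -
      let ?\<theta> = "\<epsilon> ^ (D - j) * \<mu>"
      have T: "0 < aff_val g (y z j) \<longleftrightarrow> ?\<theta> \<le> \<phi> z g" "aff_val g (y z j) < 0 \<longleftrightarrow> \<phi> z g \<le> - ?\<theta>" if z: "z \<in> X" for z
        using nested_sign_threshold[OF \<epsilon> \<epsilon>\<mu> j, of "\<lambda>i. aff_val g (y z i)", OF M[OF z g] \<mu>[OF z g] nested[OF z g]]
        unfolding \<phi>_def by blast+
      have S: "sgn (aff_val (sh (j, g, s)) (w x)) = sgn (aff_val (sh (j, g, s)) (w x'))" if "s \<in> {-1, 1}" for s
        using eq g j that unfolding sign_vector_eq_iff G_def by blast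
      have S': "sgn (\<phi> x g + s * ?\<theta>) = sgn (\<phi> x' g + s * ?\<theta>)" if "s \<in> {-1, 1}" for s
        using S[OF that] W by (simp add: val_sh sgn_divide)
      have "?\<theta> \<le> \<phi> x g \<longleftrightarrow> ?\<theta> \<le> \<phi> x' g"
        using S'[of "-1"] by (simp add: sgn_if split: if_splits)
      moreover have "\<phi> x g \<le> - ?\<theta> \<longleftrightarrow> \<phi> x' g \<le> - ?\<theta>"
        using S'[of 1] by (simp add: sgn_if split: if_splits)
      ultimately show ?thesis using T[OF x(1)] T[OF x(2)] by (auto simp: sgn_if)
    qed
    then show "(\<lambda>j\<in>{..D}. sign_vector R (y x j)) = (\<lambda>j\<in>{..D}. sign_vector R (y x' j))"
      by (intro restrict_ext) (auto simp: sign_vector_eq_iff)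
  qed
  also have "(\<lambda>x. sign_vector G (w x)) ` X = sign_vector G ` w ` X" by (simp add: image_image)
  also have "card \<dots> \<le> (2 * card G + 1) ^ DIM('e)" by (rule card_sign_vectors[OF fG])
  also have "\<dots> \<le> (4 * (D + 1) * card R + 1) ^ DIM('e)" using cG
    by (intro power_mono) (auto simp: algebra_simps)
  finally show ?thesis .
qed

section \<open>A large cell with few crossings\<close>

lemma bounding_functionals:
  fixes X :: "'e::euclidean_space set"
  assumes "finite X"
  obtains G0 :: "('e \<times> real) set" where "finite G0" "card G0 \<le> 2 * DIM('e)"
    "\<And>R x. x \<in> X \<Longrightarrow> G0 \<subseteq> R \<Longrightarrow> bounded (face R x)"
proof -
  obtain M where M: "\<And>x. x \<in> X \<Longrightarrow> norm x < M"
    using finite_imp_bounded[OF assms] by (auto simp: bounded_pos_less)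
  define G0 where "G0 = (\<lambda>(b, s). (s *\<^sub>R b, M)) ` ((Basis :: 'e set) \<times> {-1, 1::real})"
  show ?thesis
  proof (rule that[of G0])
    show "finite G0" by (simp add: G0_def)
    have "card G0 \<le> card ((Basis :: 'e set) \<times> {-1, 1::real})"
      unfolding G0_def by (rule card_image_le) simp
    then show "card G0 \<le> 2 * DIM('e)" by (simp add: card_cartesian_product)
    fix R x assume x: "x \<in> X" and R: "G0 \<subseteq> R"
    have "norm z \<le> (\<Sum>b\<in>(Basis :: 'e set). M)" if z: "z \<in> face R x" for z
    proof -
      have "\<bar>z \<bullet> b\<bar> \<le> M" if b: "b \<in> Basis" for b
      proof -
        have *: "0 \<le> s * (b \<bullet> z) + M" if s: "s \<in> {-1, 1}" for s
        proof -
          let ?g = "(s *\<^sub>R b, M)"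
          have "?g \<in> R" using b s R unfolding G0_def by force
          moreover have "\<bar>s * (b \<bullet> x)\<bar> < M"
            using M[OF x] Basis_le_norm[OF b, of x] s by (auto simp: inner_commute)
          then have "0 < aff_val ?g x" by (simp add: aff_val_def)
          ultimately have "0 \<le> aff_val ?g z" using z by (auto simp: face_def)
          then show ?thesis by (simp add: aff_val_def)
        qed
        from *[of 1] *[of "-1"] show ?thesis by (simp add: inner_commute abs_le_iff)
      qed
      then have "(\<Sum>b\<in>Basis. \<bar>z \<bullet> b\<bar>) \<le> (\<Sum>b\<in>(Basis :: 'e set). M)" by (rule sum_mono)
      then show ?thesis using norm_le_l1[of z] by linarith
    qed
    then show "bounded (face R x)" by (auto simp: bounded_iff)
  qed
qed

lemma card_cells:
  fixes X :: "'e::euclidean_space set"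
  assumes "finite X" "finite R" "\<And>x. x \<in> X \<Longrightarrow> bounded (face R x)"
  shows "card (cell_vertices R ` X) \<le> (4 * (DIM('e) + 1) * card R + 1) ^ DIM('e)"
proof -
  let ?chain = "\<lambda>x. \<lambda>j\<in>{..DIM('e)}. sign_vector R (walk R x j)"
  have "card (cell_vertices R ` X) \<le> card (?chain ` X)"
  proof (rule card_image_le_factor)
    fix x x' assume "?chain x = ?chain x'"
    then have "sign_vector R (walk R x j) = sign_vector R (walk R x' j)" if "j \<le> DIM('e)" for j
      using that by (metis atMost_iff restrict_apply')
    then have "centre R (walk R x j) = centre R (walk R x' j)" if "j \<le> DIM('e)" for j
      using that by (intro centre_cong face_cong) (auto simp: sign_vector_eq_iff)
    then show "cell_vertices R x = cell_vertices R x'"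
      unfolding cell_vertices_def by auto
  qed (use assms(1) in simp)
  also have "\<dots> \<le> (4 * (DIM('e) + 1) * card R + 1) ^ DIM('e)"
  proof (rule card_sign_chains[OF assms(1,2)])
    fix x g and i j :: nat
    assume x: "x \<in> X" and g: "g \<in> R" and "i \<le> j" and nz: "aff_val g (walk R x j) \<noteq> 0"
    then have "walk R x j \<in> face R (walk R x i)"
      using walk_in_face[OF assms(2) assms(3)[OF x]] by blast
    then show "sgn (aff_val g (walk R x i)) = sgn (aff_val g (walk R x j))"
      using g nz by (auto simp: face_def sgn_if split: if_splits)
  qed
  finally show ?thesis .
qed

text \<open>If \<open>q\<close> conflicts with \<open>V R\<close>, then removing \<open>q\<close> from \<open>insert q R\<close> changes the value of \<open>V\<close>, so \<open>q\<close> is one of the at most \<open>b\<close> elements that determine \<open>V (insert q R)\<close>.\<close>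

lemma backward_analysis:
  fixes V :: "'g set \<Rightarrow> 'v" and conf :: "'v \<Rightarrow> 'g set"
  assumes "finite H"
    and disj: "\<And>R. R \<subseteq> H \<Longrightarrow> conf (V R) \<inter> R = {}"
    and loc: "\<And>R. R \<subseteq> H \<Longrightarrow> \<exists>B\<subseteq>R. card B \<le> b \<and> (\<forall>Q. B \<subseteq> Q \<longrightarrow> Q \<subseteq> R \<longrightarrow> V Q = V R)"
  shows "(\<Sum>R | R \<subseteq> H \<and> card R = s. card (conf (V R) \<inter> H)) * Suc s \<le> b * card H * (card H choose s)"
proof -
  let ?S = "\<lambda>s. {R. R \<subseteq> H \<and> card R = s}"
  have fS: "finite (?S s)" for s using assms(1) by simp
  have "\<forall>R. \<exists>B. R \<subseteq> H \<longrightarrow> B \<subseteq> R \<and> card B \<le> b \<and> (\<forall>Q. B \<subseteq> Q \<longrightarrow> Q \<subseteq> R \<longrightarrow> V Q = V R)"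
    using loc by meson
  then obtain B where B: "\<And>R. R \<subseteq> H \<Longrightarrow> B R \<subseteq> R" "\<And>R. R \<subseteq> H \<Longrightarrow> card (B R) \<le> b"
    "\<And>R Q. R \<subseteq> H \<Longrightarrow> B R \<subseteq> Q \<Longrightarrow> Q \<subseteq> R \<Longrightarrow> V Q = V R"
    by metis
  define P where "P = (SIGMA R:?S s. conf (V R) \<inter> H)"
  have "(\<Sum>R\<in>?S s. card (conf (V R) \<inter> H)) = card P"
    unfolding P_def using assms(1) fS by (subst card_SigmaI) auto
  also have "\<dots> \<le> card (SIGMA R:?S (Suc s). B R)"
  proof (rule card_inj_on_le)
    let ?f = "\<lambda>(R, q). (insert q R, q)"
    have nin: "q \<notin> R" if "(R, q) \<in> P" for R q using that disj[of R] by (auto simp: P_def)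
    show "inj_on ?f P"
      using nin by (auto simp: inj_on_def) (metis insert_ident)+
    show "?f ` P \<subseteq> (SIGMA R:?S (Suc s). B R)"
    proof clarify
      fix R q assume Rq: "(R, q) \<in> P"
      then have R: "R \<subseteq> H" "card R = s" "q \<in> conf (V R)" "q \<in> H" by (auto simp: P_def)
      have H: "insert q R \<subseteq> H" using R by simp
      have "finite R" using R assms(1) finite_subset by blast
      have "q \<in> B (insert q R)"
      proof (rule ccontr)
        assume "q \<notin> B (insert q R)"
        then have "V R = V (insert q R)" using B(1)[OF H] by (intro B(3)[OF H]) auto
        then show False using R(3) disj[OF H] by auto
      qed
      then show "insert q R \<in> ?S (Suc s) \<and> q \<in> B (insert q R)"
        using R nin[OF Rq] \<open>finite R\<close> by auto
    qed
    have "finite (B R)" if "R \<in> ?S (Suc s)" for R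
      using that B(1)[of R] assms(1) by (auto intro: finite_subset)
    then show "finite (SIGMA R:?S (Suc s). B R)" using fS by auto
  qed
  also have "\<dots> = (\<Sum>R\<in>?S (Suc s). card (B R))"
  proof (subst card_SigmaI)
    show "\<forall>R\<in>?S (Suc s). finite (B R)"
      using B(1) assms(1) by (auto intro: finite_subset)
  qed (use fS in auto)
  also have "\<dots> \<le> (\<Sum>R\<in>?S (Suc s). b)" by (intro sum_mono) (use B(2) in auto)
  also have "\<dots> = b * (card H choose Suc s)" using n_subsets[OF assms(1)] by simp
  finally have "(\<Sum>R\<in>?S s. card (conf (V R) \<inter> H)) \<le> b * (card H choose Suc s)" .
  from mult_le_mono1[OF this, of "Suc s"]
  have "(\<Sum>R\<in>?S s. card (conf (V R) \<inter> H)) * Suc s \<le> b * (Suc s * (card H choose Suc s))"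
    by (simp only: mult_ac)
  also have "Suc s * (card H choose Suc s) = (card H - s) * (card H choose s)"
    by (simp only: binomial_absorption binomial_absorb_comp)
  also have "b * \<dots> \<le> b * (card H * (card H choose s))" by (intro mult_left_mono mult_right_mono) auto
  finally show ?thesis by (simp add: mult.assoc)
qed

lemma pigeonhole_fibre:
  assumes "finite A" "A \<noteq> {}"
  shows "\<exists>v. card A \<le> card (f ` A) * card {x \<in> A. f x = v}"
proof (rule ccontr)
  assume "\<not> ?thesis"
  then have less: "card (f ` A) * card {x \<in> A. f x = v} < card A" for v by (simp add: not_le)
  have "card A * card (f ` A) = (\<Sum>v\<in>f ` A. card {x \<in> A. f x = v}) * card (f ` A)"
    using sum.image_gen[OF assms(1), of "\<lambda>_. 1::nat" f] by simp
  also have "\<dots> = (\<Sum>v\<in>f ` A. card (f ` A) * card {x \<in> A. f x = v})"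
    by (simp add: sum_distrib_left mult.commute)
  also have "\<dots> < (\<Sum>v\<in>f ` A. card A)"
    using assms less by (intro sum_strict_mono) auto
  finally show False by (simp add: mult.commute)
qed

definition separated :: "'e::euclidean_space set \<Rightarrow> ('e \<times> real) set" where
  "separated V = {g. \<exists>u\<in>V. \<exists>v\<in>V. aff_val g u < 0 \<and> 0 < aff_val g v}"

lemma large_cell_few_crossings:
  fixes X :: "'e::euclidean_space set" and H :: "('e \<times> real) set"
  assumes "finite X" "X \<noteq> {}" "finite H" "1 \<le> s" "s \<le> card H"
  obtains Y K where "Y \<subseteq> X" "K \<subseteq> H"
    "card X \<le> 2 * (4 * (DIM('e) + 1) * (s + 2 * DIM('e)) + 1) ^ DIM('e) * card Y"
    "card K * s \<le> 2 * (DIM('e) + 1)\<^sup>2 * card H"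
    "\<And>g x x'. g \<in> H - K \<Longrightarrow> x \<in> Y \<Longrightarrow> x' \<in> Y \<Longrightarrow> aff_val g x = 0 \<Longrightarrow> aff_val g x' = 0"
proof -
  obtain G0 :: "('e \<times> real) set" where G0: "finite G0" "card G0 \<le> 2 * DIM('e)"
    and bd: "\<And>R x. x \<in> X \<Longrightarrow> G0 \<subseteq> R \<Longrightarrow> bounded (face R x)"
    using bounding_functionals[OF assms(1)] by blast
  define b where "b = (DIM('e) + 1)\<^sup>2"
  define V where "V x R = cell_vertices (R \<union> G0) x" for x R
  define k where "k x R = card (separated (V x R) \<inter> H)" for x R
  let ?S = "{R. R \<subseteq> H \<and> card R = s}"
  let ?n = "card H"
  have fin: "finite (R \<union> G0)" if "R \<subseteq> H" for R using that G0 assms(3) finite_subset by blast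
  have avg: "(\<Sum>R\<in>?S. k x R) * s \<le> b * ?n * (?n choose s)" if x: "x \<in> X" for x
  proof -
    have "(\<Sum>R\<in>?S. k x R) * Suc s \<le> b * ?n * (?n choose s)"
      unfolding k_def
    proof (rule backward_analysis[of H separated "V x", OF assms(3)])
      fix R assume R: "R \<subseteq> H"
      have bR: "bounded (face (R \<union> G0) x)" using bd x by simp
      show "separated (V x R) \<inter> R = {}"
        using cell_vertices_not_separated[OF fin[OF R] bR] unfolding separated_def V_def by blast
      obtain B where B: "B \<subseteq> R \<union> G0" "card B \<le> b"
        "\<And>Q. B \<subseteq> Q \<Longrightarrow> Q \<subseteq> R \<union> G0 \<Longrightarrow> cell_vertices Q x = cell_vertices (R \<union> G0) x"
        using cell_vertices_local[OF fin[OF R] bR] unfolding b_def by blast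
      have "finite B" using B(1) fin[OF R] finite_subset by blast
      then have "card (B \<inter> R) \<le> b" using B(2) card_mono[of B "B \<inter> R"] by simp
      moreover have "V x Q = V x R" if "B \<inter> R \<subseteq> Q" "Q \<subseteq> R" for Q
        unfolding V_def using B(1) that by (intro B(3)) auto
      ultimately show "\<exists>B\<subseteq>R. card B \<le> b \<and> (\<forall>Q. B \<subseteq> Q \<longrightarrow> Q \<subseteq> R \<longrightarrow> V x Q = V x R)"
        by (meson Int_lower2)
    qed
    then show ?thesis by (simp add: algebra_simps)
  qed
  have "\<exists>R\<in>?S. (\<Sum>x\<in>X. k x R) * s \<le> card X * (b * ?n)"
  proof (rule ccontr)
    assume "\<not> ?thesis"
    then have "\<And>R. R \<in> ?S \<Longrightarrow> card X * (b * ?n) < (\<Sum>x\<in>X. k x R) * s" by (meson not_le)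
    moreover have "?S \<noteq> {}" using obtain_subset_with_card_n[OF assms(5)] by blast
    moreover have "finite ?S" using assms(3) by simp
    ultimately have "(\<Sum>R\<in>?S. card X * (b * ?n)) < (\<Sum>R\<in>?S. (\<Sum>x\<in>X. k x R) * s)"
      by (intro sum_strict_mono) auto
    also have "\<dots> = (\<Sum>x\<in>X. (\<Sum>R\<in>?S. k x R) * s)"
      unfolding sum_distrib_right by (rule sum.swap)
    also have "\<dots> \<le> (\<Sum>x\<in>X. b * ?n * (?n choose s))" by (intro sum_mono avg)
    finally show False using n_subsets[OF assms(3), of s] by simp
  qed
  then obtain R where R: "R \<subseteq> H" "card R = s" "(\<Sum>x\<in>X. k x R) * s \<le> card X * (b * ?n)" by blast
  define good where "good = {x \<in> X. k x R * s \<le> 2 * (b * ?n)}"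
  define bad where "bad = {x \<in> X. 2 * (b * ?n) < k x R * s}"
  have "card bad * (2 * (b * ?n)) = (\<Sum>x\<in>bad. 2 * (b * ?n))" by simp
  also have "\<dots> \<le> (\<Sum>x\<in>bad. k x R * s)" by (intro sum_mono) (auto simp: bad_def)
  also have "\<dots> \<le> (\<Sum>x\<in>X. k x R * s)"
    using assms(1) by (intro sum_mono2) (auto simp: bad_def)
  also have "\<dots> \<le> card X * (b * ?n)" using R(3) by (simp add: sum_distrib_right)
  finally have "(2 * card bad) * (b * ?n) \<le> card X * (b * ?n)" by (simp add: algebra_simps)
  moreover have "0 < b * ?n" using assms(4,5) by (simp add: b_def)
  ultimately have "2 * card bad \<le> card X" using mult_le_cancel2 by blast
  moreover have "card X = card good + card bad"
  proof -
    have "X = good \<union> bad" "good \<inter> bad = {}" by (auto simp: good_def bad_def)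
    moreover have "finite good" "finite bad" using assms(1) by (auto simp: good_def bad_def)
    ultimately show ?thesis by (simp add: card_Un_disjoint)
  qed
  ultimately have half: "card X \<le> 2 * card good" by simp
  have "0 < card X" using assms(1,2) by (simp add: card_gt_0_iff)
  then have "0 < card good" using half by simp
  then have good: "finite good" "good \<noteq> {}" using card_gt_0_iff by blast+
  obtain v where v: "card good \<le> card ((\<lambda>x. V x R) ` good) * card {x \<in> good. V x R = v}"
    using pigeonhole_fibre[OF good, of "\<lambda>x. V x R"] by (elim exE)
  define Y where "Y = {x \<in> good. V x R = v}"
  define L where "L = (4 * (DIM('e) + 1) * (s + 2 * DIM('e)) + 1) ^ DIM('e)"
  have "card ((\<lambda>x. V x R) ` good) \<le> (4 * (DIM('e) + 1) * card (R \<union> G0) + 1) ^ DIM('e)"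
    unfolding V_def by (rule card_cells[OF good(1) fin[OF R(1)]]) (auto intro!: bd simp: good_def)
  also have "\<dots> \<le> L" unfolding L_def
  proof (intro power_mono add_mono mult_mono order_refl)
    show "card (R \<union> G0) \<le> s + 2 * DIM('e)" using card_Un_le[of R G0] R(2) G0(2) by linarith
  qed auto
  finally have "card good \<le> L * card Y"
    using v unfolding Y_def by (meson le_trans mult_le_mono1)
  then have card_Y: "card X \<le> 2 * L * card Y" using half by simp
  have "card Y \<noteq> 0"
  proof
    assume "card Y = 0"
    then show False using card_Y \<open>0 < card X\<close> by simp
  qed
  then obtain y where y: "y \<in> Y" by (metis card.empty equals0I)
  define K where "K = separated v \<inter> H"
  have "card K * s \<le> 2 * (b * ?n)" using y by (auto simp: Y_def good_def K_def k_def)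
  moreover have "aff_val g x' = 0" if "g \<in> H - K" "x \<in> Y" "x' \<in> Y" "aff_val g x = 0" for g x x'
  proof -
    have cv: "cell_vertices (R \<union> G0) z = v" "bounded (face (R \<union> G0) z)" if "z \<in> Y" for z
      using that bd by (auto simp: Y_def V_def good_def)
    show ?thesis
    proof (rule zero_on_cell_vertices[OF fin[OF R(1)] cv(2)[OF that(3)]])
      fix u assume "u \<in> cell_vertices (R \<union> G0) x'"
      then have u: "u \<in> cell_vertices (R \<union> G0) x" using cv(1) that(2,3) by simp
      show "aff_val g u = 0"
        by (rule incident_imp_separated_or_zero[OF fin[OF R(1)] cv(2)[OF that(2)] that(4) _ u])
          (use that cv(1)[OF that(2)] in \<open>auto simp: K_def separated_def\<close>)
    qed
  qed
  ultimately show ?thesis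
    using card_Y by (intro that[of Y K]) (auto simp: Y_def good_def K_def L_def b_def mult.assoc)
qed

section \<open>Counting rich spheres\<close>

lemma few_sets_with_small_intersections:
  fixes A :: "'i \<Rightarrow> 'g set" and k t :: real
  assumes "finite Y" "finite K" "0 < k" "0 \<le> t"
    and sub: "\<And>i. i \<in> Y \<Longrightarrow> A i \<subseteq> K" and large: "\<And>i. i \<in> Y \<Longrightarrow> k \<le> card (A i)"
    and small: "\<And>i j. i \<in> Y \<Longrightarrow> j \<in> Y \<Longrightarrow> i \<noteq> j \<Longrightarrow> card (A i \<inter> A j) \<le> t"
    and "2 * real (card K) * t \<le> k\<^sup>2"
  shows "real (card Y) * k \<le> 2 * real (card K)"
proof -
  define I where "I = (\<Sum>i\<in>Y. real (card (A i)))"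
  define deg where "deg p = (\<Sum>i\<in>Y. if p \<in> A i then 1 else 0 :: real)" for p
  have card_eq: "(\<Sum>p\<in>K. if p \<in> B then 1 else 0 :: real) = card B" if "B \<subseteq> K" for B
    using that assms(2) by (simp add: sum.If_cases Int_absorb1)
  have "(\<Sum>p\<in>K. deg p) = I"
    unfolding deg_def I_def by (subst sum.swap) (intro sum.cong refl card_eq sub)
  moreover have "(\<Sum>p\<in>K. (deg p)\<^sup>2) \<le> I + (real (card Y))\<^sup>2 * t"
  proof -
    have "(deg p)\<^sup>2 = (\<Sum>i\<in>Y. \<Sum>j\<in>Y. if p \<in> A i \<inter> A j then 1 else 0)" for p
      unfolding power2_eq_square deg_def sum_product by (intro sum.cong refl) simp
    then have "(\<Sum>p\<in>K. (deg p)\<^sup>2) = (\<Sum>i\<in>Y. \<Sum>j\<in>Y. \<Sum>p\<in>K. if p \<in> A i \<inter> A j then 1 else 0)"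
      by (simp only: sum.swap[of _ Y K])
    also have "\<dots> = (\<Sum>i\<in>Y. \<Sum>j\<in>Y. real (card (A i \<inter> A j)))"
      using sub by (intro sum.cong refl card_eq) blast
    also have "\<dots> \<le> (\<Sum>i\<in>Y. \<Sum>j\<in>Y. (if j = i then real (card (A i)) else 0) + t)"
      using small assms(4) by (intro sum_mono) auto
    also have "\<dots> = I + (real (card Y))\<^sup>2 * t"
      using assms(1) by (simp add: sum.distrib I_def power2_eq_square)
    finally show ?thesis .
  qed
  ultimately have CS: "I\<^sup>2 \<le> (I + (real (card Y))\<^sup>2 * t) * card K"
    using sum_squared_le_sum_of_squares[of deg K] by (smt (verit) mult_right_mono of_nat_0_le_iff)
  have "(\<Sum>i\<in>Y. k) \<le> I" unfolding I_def by (intro sum_mono large)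
  then have I: "card Y * k \<le> I" by simp
  have "2 * ((real (card Y))\<^sup>2 * t * real (card K)) = (real (card Y))\<^sup>2 * (2 * real (card K) * t)" by simp
  also have "\<dots> \<le> (real (card Y))\<^sup>2 * k\<^sup>2" by (intro mult_left_mono assms) simp
  also have "\<dots> = (card Y * k)\<^sup>2" by (simp add: power_mult_distrib)
  also have "\<dots> \<le> I\<^sup>2" using I assms(3) by (intro power_mono) auto
  finally have "I * I \<le> 2 * real (card K) * I" using CS by (simp add: algebra_simps power2_eq_square)
  moreover have "0 \<le> I" unfolding I_def by (intro sum_nonneg) simp
  ultimately have "I \<le> 2 * real (card K)"
    by (cases "I = 0") (auto simp: mult_le_cancel_right)
  then show ?thesis using I by simp
qed

lemma rich_points_bound:
  fixes X :: "'e::euclidean_space set" and H :: "('e \<times> real) set" and k T b C :: real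
  defines "b \<equiv> real ((DIM('e) + 1)\<^sup>2)"
    and "C \<equiv> real (4 * (DIM('e) + 1) * (2 * DIM('e) + 1) + 1)"
  assumes finX: "finite X" and finH: "finite H" and T0: "0 < T" and k1: "1 \<le> k" and Tk: "32 * b * T \<le> k"
    and rich: "\<And>x. x \<in> X \<Longrightarrow> k \<le> card {g \<in> H. aff_val g x = 0}"
    and small: "\<And>x x'. x \<in> X \<Longrightarrow> x' \<in> X \<Longrightarrow> x \<noteq> x' \<Longrightarrow>
      card {g \<in> H. aff_val g x = 0 \<and> aff_val g x' = 0} \<le> T"
  shows "real (card X) \<le> (32 * b * C * real (card H) * T / k\<^sup>2) ^ DIM('e) * (k / T) + 2 * real (card H) / k"
proof -
  let ?n = "real (card H)"
  define Z where "Z x = {g \<in> H. aff_val g x = 0}" for x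
  have b: "1 \<le> b" by (simp add: b_def)
  have C: "1 \<le> C" by (simp add: C_def)
  have inter: "card (Z x \<inter> Z x') \<le> T" if "x \<in> X" "x' \<in> X" "x \<noteq> x'" for x x'
  proof -
    have "Z x \<inter> Z x' = {g \<in> H. aff_val g x = 0 \<and> aff_val g x' = 0}" by (auto simp: Z_def)
    then show ?thesis using small[OF that] by simp
  qed
  have "b * T \<ge> 1 * T" using b T0 by (intro mult_right_mono) auto
  then have T2: "T \<le> k / 2" using Tk T0 by linarith
  define z where "z = 16 * b * ?n * T / k\<^sup>2"
  show ?thesis
  proof (cases "X = {} \<or> z < 1")
    case True
    have "real (card X) * k \<le> 2 * ?n"
    proof (cases "X = {}")
      case False
      with True have "16 * b * ?n * T < k\<^sup>2" using k1 by (simp add: z_def divide_simps)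
      moreover have "2 * ?n * T \<le> 16 * b * ?n * T" using b T0
        by (intro mult_right_mono) (auto intro: mult_right_mono)
      ultimately have "2 * ?n * T \<le> k\<^sup>2" by linarith
      then show ?thesis
        using finX finH k1 T0 inter rich
        by (intro few_sets_with_small_intersections[of X H k T Z]) (auto simp: Z_def)
    qed simp
    then have "card X \<le> 2 * ?n / k" using k1 by (simp add: field_simps)
    moreover have "0 \<le> (32 * b * C * ?n * T / k\<^sup>2) ^ DIM('e) * (k / T)"
      using b C T0 k1 by simp
    ultimately show ?thesis by linarith
  next
    case False
    define s where "s = nat \<lceil>z\<rceil>"
    have z1: "1 \<le> z" and X: "X \<noteq> {}" using False by auto
    have s: "z \<le> s" "s \<le> z + 1" unfolding s_def using z1 by linarith+
    then have s2: "s \<le> 2 * z" using z1 by linarith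
    have s1: "1 \<le> s" using s(1) z1 by linarith
    have "s \<le> ?n"
    proof -
      have "k \<le> k\<^sup>2" using k1 by (simp add: power2_eq_square)
      then have "32 * b * T / k\<^sup>2 \<le> 1" using Tk k1 by (simp add: divide_simps)
      then have "?n * (32 * b * T / k\<^sup>2) \<le> ?n * 1" by (intro mult_left_mono) auto
      moreover have "2 * z = ?n * (32 * b * T / k\<^sup>2)" by (simp add: z_def)
      ultimately show ?thesis using s2 by linarith
    qed
    then have "s \<le> card H" by simp
    then obtain Y K where Y: "Y \<subseteq> X" "K \<subseteq> H"
      and cX: "card X \<le> 2 * (4 * (DIM('e) + 1) * (s + 2 * DIM('e)) + 1) ^ DIM('e) * card Y"
      and cK: "card K * s \<le> 2 * (DIM('e) + 1)\<^sup>2 * card H"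
      and K: "\<And>g x x'. g \<in> H - K \<Longrightarrow> x \<in> Y \<Longrightarrow> x' \<in> Y \<Longrightarrow> aff_val g x = 0 \<Longrightarrow> aff_val g x' = 0"
      using large_cell_few_crossings[OF finX X finH s1] by blast
    have fin: "finite Y" "finite K" using Y finX finH finite_subset by blast+
    have "real (card K * s) \<le> real (2 * (DIM('e) + 1)\<^sup>2 * card H)" using cK by (simp only: of_nat_le_iff)
    then have cK': "real (card K) * real s \<le> 2 * b * ?n" by (simp add: b_def)
    have "real (card K) * z \<le> real (card K) * real s" using s by (intro mult_left_mono) auto
    with cK' have "real (card K) * (16 * b * ?n * T / k\<^sup>2) \<le> 2 * b * ?n" unfolding z_def by linarith
    then have "(8 * real (card K) * T / k\<^sup>2) * (2 * b * ?n) \<le> 1 * (2 * b * ?n)" by (simp add: algebra_simps)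
    moreover have "0 < 2 * b * ?n" using b \<open>s \<le> ?n\<close> s1 by simp
    ultimately have "8 * real (card K) * T / k\<^sup>2 \<le> 1" using mult_le_cancel_right_pos by blast
    then have KT: "8 * real (card K) * T \<le> k\<^sup>2" using k1 by (simp add: divide_simps)
    have cY: "card Y \<le> k / (2 * T)"
    proof (cases "card Y \<le> 1")
      case True
      then have "real (card Y) \<le> 1" by simp
      also have "1 \<le> k / (2 * T)" using T2 T0 by (simp add: field_simps)
      finally show ?thesis .
    next
      case False
      have "real (card Y) * (k / 2) \<le> 2 * real (card K)"
      proof (rule few_sets_with_small_intersections[where A = "\<lambda>x. Z x \<inter> K" and t = T, OF fin])
        show "2 * real (card K) * T \<le> (k / 2)\<^sup>2" using KT by (simp add: power_divide)
        fix x assume x: "x \<in> Y"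
        have "\<exists>x'\<in>Y. x' \<noteq> x"
        proof (rule ccontr)
          assume "\<not> ?thesis"
          then have "Y \<subseteq> {x}" by blast
          from card_mono[OF _ this] False show False by simp
        qed
        then obtain x' where x': "x' \<in> Y" "x' \<noteq> x" by blast
        have fZ: "finite (Z x)" for x using finH by (simp add: Z_def)
        have "Z x - K \<subseteq> Z x \<inter> Z x'" using K x x' by (auto simp: Z_def)
        then have "card (Z x - K) \<le> card (Z x \<inter> Z x')" by (intro card_mono) (auto simp: fZ)
        also have "\<dots> \<le> T" using inter x x' Y by blast
        finally have 1: "card (Z x - K) \<le> T" by simp
        have "card (Z x) = card (Z x \<inter> K) + card (Z x - K)"
          using card_Int_Diff[OF fZ] .
        moreover have "k \<le> card (Z x)" using rich x Y by (auto simp: Z_def)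
        ultimately show "k / 2 \<le> card (Z x \<inter> K)" using 1 T2 by linarith
      next
        fix x x' assume x: "x \<in> Y" "x' \<in> Y" "x \<noteq> x'"
        have "card (Z x \<inter> K \<inter> (Z x' \<inter> K)) \<le> card (Z x \<inter> Z x')"
          using finH by (intro card_mono) (auto simp: Z_def)
        also have "\<dots> \<le> T" using inter x Y by blast
        finally show "card (Z x \<inter> K \<inter> (Z x' \<inter> K)) \<le> T" by simp
      qed (use T0 k1 in auto)
      then have "real (card Y) * k \<le> 4 * real (card K)" by simp
      then have "real (card Y) * k * (2 * T) \<le> 4 * real (card K) * (2 * T)" using T0 by (intro mult_right_mono) auto
      also have "\<dots> \<le> k * k" using KT by (simp add: power2_eq_square)
      finally have "real (card Y) * (2 * T) \<le> k" using k1 by simp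
      then show ?thesis using T0 by (simp add: field_simps)
    qed
    have "4 * (DIM('e) + 1) * (s + 2 * DIM('e)) + 1 \<le> 4 * (DIM('e) + 1) * (s * (2 * DIM('e) + 1)) + s"
    proof (intro add_mono mult_left_mono)
      show "s + 2 * DIM('e) \<le> s * (2 * DIM('e) + 1)" using s1 by (cases s) auto
    qed (use s1 in auto)
    then have "real (4 * (DIM('e) + 1) * (s + 2 * DIM('e)) + 1) \<le> C * s"
      unfolding C_def of_nat_mult[symmetric] of_nat_le_iff by (simp add: algebra_simps)
    also have "\<dots> \<le> C * (2 * z)" using s2 C by (intro mult_left_mono) auto
    also have "C * (2 * z) = 32 * b * C * ?n * T / k\<^sup>2" by (simp add: z_def)
    finally have base: "real (4 * (DIM('e) + 1) * (s + 2 * DIM('e)) + 1) \<le> 32 * b * C * ?n * T / k\<^sup>2" .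
    have "real (card X) \<le> real (2 * (4 * (DIM('e) + 1) * (s + 2 * DIM('e)) + 1) ^ DIM('e) * card Y)"
      using cX by (simp only: of_nat_le_iff)
    also have "\<dots> = real (4 * (DIM('e) + 1) * (s + 2 * DIM('e)) + 1) ^ DIM('e) * (2 * real (card Y))"
      by (simp only: of_nat_mult of_nat_power of_nat_numeral mult_ac)
    also have "\<dots> \<le> (32 * b * C * ?n * T / k\<^sup>2) ^ DIM('e) * (k / T)"
    proof (intro mult_mono power_mono base)
      show "2 * real (card Y) \<le> k / T" using cY T0 by (simp add: field_simps)
    qed (use b C T0 k1 in auto)
    finally show ?thesis using k1 by (simp add: add_increasing2)
  qed
qed

lemma codim2_sphere_through:
  fixes p :: "'a::euclidean_space"
  assumes "2 \<le> DIM('a)"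
  shows "\<exists>S. codim2_sphere S \<and> p \<in> S"
proof -
  obtain e :: 'a where e: "e \<in> Basis" using nonempty_Basis by blast
  have "Basis - {e} \<noteq> {}"
  proof
    assume "Basis - {e} = {}"
    then have "Basis \<subseteq> {e}" by blast
    from card_mono[OF _ this] assms show False by simp
  qed
  then obtain u :: 'a where u: "u \<in> Basis" "u \<noteq> e" by blast
  have "u \<noteq> 0" using u nonzero_Basis by blast
  then have "codim2_sphere (sphere (p - e) 1 \<inter> {x. u \<bullet> (x - (p - e)) = 0})"
    unfolding codim2_sphere_def by (intro exI[of _ "p - e"] exI[of _ 1] exI[of _ u]) auto
  moreover have "p \<in> sphere (p - e) 1 \<inter> {x. u \<bullet> (x - (p - e)) = 0}"
    using e u by (simp add: dist_norm inner_Basis)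
  ultimately show ?thesis by blast
qed

lemma hypersphere_Int_subset_codim2:
  fixes S S' :: "'a::euclidean_space set"
  assumes "2 \<le> DIM('a)" "hypersphere S" "hypersphere S'" "S \<noteq> S'"
  shows "\<exists>C. codim2_sphere C \<and> S \<inter> S' \<subseteq> C"
proof -
  obtain a r where S: "S = sphere a r" using assms(2) by (auto simp: hypersphere_def)
  obtain b q where S': "S' = sphere b q" using assms(3) by (auto simp: hypersphere_def)
  show ?thesis
  proof (cases "S \<inter> S' = {}")
    case True
    then show ?thesis using codim2_sphere_through[OF assms(1), of 0] by auto
  next
    case False
    then obtain x0 where x0: "x0 \<in> S" "x0 \<in> S'" by blast
    define u where "u = b - a"
    have "u \<noteq> 0"
    proof
      assume "u = 0"
      then have "a = b" by (simp add: u_def)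
      then have "r = q" using x0 S S' by simp
      then show False using \<open>a = b\<close> S S' assms(4) by simp
    qed
    define m where "m = (r\<^sup>2 - q\<^sup>2 + u \<bullet> u) / (2 * (u \<bullet> u))"
    define c where "c = a + m *\<^sub>R u"
    have orth: "u \<bullet> (x - c) = 0" and rad: "(norm (x - c))\<^sup>2 = r\<^sup>2 - m\<^sup>2 * (u \<bullet> u)"
      if x: "x \<in> S \<inter> S'" for x
    proof -
      define w where "w = x - a"
      have 1: "w \<bullet> w = r\<^sup>2" using x by (simp add: S w_def dist_norm norm_minus_commute flip: power2_norm_eq_inner)
      have "x - b = w - u" by (simp add: w_def u_def)
      moreover have "(x - b) \<bullet> (x - b) = q\<^sup>2" using x by (simp add: S' dist_norm norm_minus_commute flip: power2_norm_eq_inner)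
      ultimately have "(w - u) \<bullet> (w - u) = q\<^sup>2" by simp
      then have 2: "2 * (u \<bullet> w) = r\<^sup>2 - q\<^sup>2 + u \<bullet> u" using 1 by (simp add: inner_diff_left inner_diff_right inner_commute)
      have uu: "u \<bullet> u \<noteq> 0" using \<open>u \<noteq> 0\<close> by simp
      have 3: "u \<bullet> w = m * (u \<bullet> u)" unfolding m_def 2[symmetric] using uu by simp
      have xc: "x - c = w - m *\<^sub>R u" by (simp add: c_def w_def)
      show "u \<bullet> (x - c) = 0" unfolding xc using 3 by (simp add: inner_diff_right)
      show "(norm (x - c))\<^sup>2 = r\<^sup>2 - m\<^sup>2 * (u \<bullet> u)"
        unfolding xc power2_norm_eq_inner using 1 3
        by (simp add: inner_diff_left inner_diff_right inner_commute power2_eq_square)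
    qed
    define \<rho> where "\<rho> = norm (x0 - c)"
    have rad': "norm (x - c) = \<rho>" if "x \<in> S \<inter> S'" for x
    proof -
      have "(norm (x - c))\<^sup>2 = \<rho>\<^sup>2" using rad[OF that] rad[of x0] x0 by (simp add: \<rho>_def)
      then show ?thesis by (simp add: \<rho>_def)
    qed
    show ?thesis
    proof (cases "\<rho> = 0")
      case True
      then have "S \<inter> S' \<subseteq> {c}" using rad' by auto
      then show ?thesis using codim2_sphere_through[OF assms(1), of c] by blast
    next
      case False
      then have "0 < \<rho>" by (simp add: \<rho>_def)
      then have "codim2_sphere (sphere c \<rho> \<inter> {x. u \<bullet> (x - c) = 0})"
        unfolding codim2_sphere_def using \<open>u \<noteq> 0\<close> by blast
      moreover have "S \<inter> S' \<subseteq> sphere c \<rho> \<inter> {x. u \<bullet> (x - c) = 0}"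
        using orth rad' by (auto simp: dist_norm norm_minus_commute)
      ultimately show ?thesis by blast
    qed
  qed
qed

lemma aff_val_lift:
  fixes p c :: "'a::euclidean_space"
  shows "aff_val ((- (2 *\<^sub>R p), 1), p \<bullet> p) (c, c \<bullet> c - r\<^sup>2) = (dist c p)\<^sup>2 - r\<^sup>2"
  by (simp add: aff_val_def dist_norm power2_norm_eq_inner inner_diff_left inner_diff_right inner_commute)

lemma rich_spheres_bound:
  fixes P :: "'a::euclidean_space set" and F :: "'a set set" and T :: real
  defines "b \<equiv> real ((DIM('a) + 2)\<^sup>2)"
    and "C \<equiv> real (4 * (DIM('a) + 2) * (2 * DIM('a) + 3) + 1)"
  assumes dim: "2 \<le> DIM('a)" and finF: "finite F" and finP: "finite P" and T0: "0 < T" and k1: "1 \<le> k"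
    and Tk: "32 * b * T \<le> real k"
    and F: "F \<subseteq> rich_hyperspheres k P"
    and codim2: "\<And>S. codim2_sphere S \<Longrightarrow> real (card (S \<inter> P)) \<le> T"
  shows "real (card F) \<le> (32 * b * C * real (card P) * T / (real k)\<^sup>2) ^ (DIM('a) + 1) * (real k / T)
    + 2 * real (card P) / real k"
proof -
  define \<phi> where "\<phi> p = ((- (2 *\<^sub>R p), 1::real), p \<bullet> p)" for p :: 'a
  define H where "H = \<phi> ` P"
  have inj_\<phi>: "inj_on \<phi> A" for A by (auto simp: inj_on_def \<phi>_def)
  have cH: "card H = card P" unfolding H_def by (rule card_image[OF inj_\<phi>])
  have "\<exists>x. S = {p. aff_val (\<phi> p) x = 0}" if "S \<in> F" for S
  proof -
    have "hypersphere S" using F that by (auto simp: rich_hyperspheres_def)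
    then obtain c r where S: "r > 0" "S = sphere c r" unfolding hypersphere_def by blast
    have eq: "aff_val (\<phi> p) (c, c \<bullet> c - r\<^sup>2) = 0 \<longleftrightarrow> dist c p = r" for p
      unfolding \<phi>_def aff_val_lift using S(1) by (auto simp: power2_eq_iff_nonneg)
    have "S = {p. aff_val (\<phi> p) (c, c \<bullet> c - r\<^sup>2) = 0}" unfolding eq S(2) sphere_def ..
    then show ?thesis by blast
  qed
  then obtain \<xi> where \<xi>: "\<And>S. S \<in> F \<Longrightarrow> S = {p. aff_val (\<phi> p) (\<xi> S) = 0}" by metis
  have "inj_on \<xi> F" using \<xi> by (metis inj_onI)
  then have cX: "card (\<xi> ` F) = card F" by (rule card_image)
  have Z: "{g \<in> H. aff_val g (\<xi> S) = 0} = \<phi> ` (S \<inter> P)" if "S \<in> F" for S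
    using \<xi>[OF that] by (auto simp: H_def)
  have rich: "real k \<le> real (card {g \<in> H. aff_val g x = 0})" if x: "x \<in> \<xi> ` F" for x
  proof -
    obtain S where S: "S \<in> F" "x = \<xi> S" using x by blast
    have "card {g \<in> H. aff_val g x = 0} = card (S \<inter> P)"
      unfolding S(2) Z[OF S(1)] by (rule card_image[OF inj_\<phi>])
    moreover have "k \<le> card (S \<inter> P)" using F S(1) by (auto simp: rich_hyperspheres_def)
    ultimately show ?thesis by simp
  qed
  have small: "real (card {g \<in> H. aff_val g x = 0 \<and> aff_val g x' = 0}) \<le> T"
    if x: "x \<in> \<xi> ` F" "x' \<in> \<xi> ` F" "x \<noteq> x'" for x x'
  proof -
    obtain S S' where S: "S \<in> F" "x = \<xi> S" "S' \<in> F" "x' = \<xi> S'" using x by blast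
    have "{g \<in> H. aff_val g x = 0 \<and> aff_val g x' = 0} =
        {g \<in> H. aff_val g x = 0} \<inter> {g \<in> H. aff_val g x' = 0}" by blast
    also have "\<dots> = \<phi> ` (S \<inter> S' \<inter> P)"
      unfolding S(2,4) Z[OF S(1)] Z[OF S(3)] image_Int[OF inj_\<phi>, symmetric]
      by (intro arg_cong[of _ _ "image \<phi>"]) blast
    finally have eq: "card {g \<in> H. aff_val g x = 0 \<and> aff_val g x' = 0} = card (S \<inter> S' \<inter> P)"
      by (simp add: card_image[OF inj_\<phi>])
    have "S \<noteq> S'" using x S by auto
    then obtain D where D: "codim2_sphere D" "S \<inter> S' \<subseteq> D"
      using hypersphere_Int_subset_codim2[OF dim, of S S'] F S unfolding rich_hyperspheres_def by blast
    have "card (S \<inter> S' \<inter> P) \<le> card (D \<inter> P)" using D(2) finP by (intro card_mono) auto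
    also have "\<dots> \<le> T" by (rule codim2[OF D(1)])
    finally show ?thesis using eq by simp
  qed
  have "real (card (\<xi> ` F)) \<le> (32 * b * C * real (card H) * T / (real k)\<^sup>2) ^ DIM('a \<times> real) * (real k / T)
    + 2 * real (card H) / real k"
    using rich_points_bound[of "\<xi> ` F" H T "real k", OF _ _ T0 _ _ rich small] finF finP k1 Tk
    by (simp add: b_def C_def H_def algebra_simps)
  then show ?thesis by (simp add: cX cH)
qed

theorem theorem4:
  assumes "DIM('a::euclidean_space) \<ge> 3"
  shows "\<exists>c>0. \<forall>\<alpha>::real. real DIM('a) + 1 \<le> \<alpha> \<and> \<alpha> < 2 * real DIM('a) + 1 \<longrightarrow>
           (\<exists>c'>0. \<forall>(k::nat) (P::'a set).
              k \<ge> DIM('a) + 1 \<and> finite P \<and> P \<noteq> {} \<and>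
              (infinite (rich_hyperspheres k P) \<or>
               real (card (rich_hyperspheres k P)) \<ge>
                 c * (real (card P) ^ (DIM('a) + 1) / real k powr \<alpha> + real (card P) / real k))
              \<longrightarrow> (\<exists>S. codim2_sphere S \<and>
                     real (card (S \<inter> P)) \<ge> c' * real k powr ((2 * real DIM('a) + 1 - \<alpha>) / real DIM('a))))"
proof -
  let ?d = "DIM('a)"
  define b where "b = real ((?d + 2)\<^sup>2)"
  define C where "C = real (4 * (?d + 2) * (2 * ?d + 3) + 1)"
  define E where "E = (32 * b * C) ^ (?d + 1)"
  define c' where "c' = 1 / (32 * b * E)"
  have b: "1 \<le> b" and C: "1 \<le> C" by (auto simp: b_def C_def)
  have "1 \<le> b * C" using mult_mono[OF b C] b by simp
  then have E: "1 \<le> E" unfolding E_def by (intro one_le_power) simp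
  have bE: "b \<le> b * E" "E \<le> b * E" using b E by simp_all
  have c'0: "0 < c'" using b E by (simp add: c'_def)
  have c'b: "32 * b * c' \<le> 1" using b E by (simp add: c'_def field_simps)
  have c'E: "E * c' \<le> 1" using b E by (simp add: c'_def field_simps)
  have c'1: "c' \<le> 1" using mult_right_mono[OF E less_imp_le[OF c'0]] c'E by linarith
  have main: "\<exists>S. codim2_sphere S \<and> real (card (S \<inter> P)) \<ge> c' * real k powr ((2 * real ?d + 1 - \<alpha>) / real ?d)"
    if \<alpha>: "real ?d + 1 \<le> \<alpha>" and k: "?d + 1 \<le> k" and P: "finite P" "P \<noteq> {}"
      and many: "infinite (rich_hyperspheres k P) \<or> real (card (rich_hyperspheres k P)) \<ge>
        3 * (real (card P) ^ (?d + 1) / real k powr \<alpha> + real (card P) / real k)"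
    for \<alpha> :: real and k :: nat and P :: "'a set"
  proof (rule ccontr)
    assume contr: "\<not> ?thesis"
    define \<beta> where "\<beta> = (2 * real ?d + 1 - \<alpha>) / real ?d"
    define T where "T = c' * real k powr \<beta>"
    let ?n = "real (card P)" and ?k = "real k"
    have k1: "1 \<le> k" "1 \<le> ?k" using k by simp_all
    have n0: "0 < ?n" using P by (simp add: card_gt_0_iff)
    have T0: "0 < T" using c'0 k1 by (simp add: T_def)
    have "\<beta> \<le> 1" using \<alpha> by (simp add: \<beta>_def divide_le_eq)
    then have "?k powr \<beta> \<le> ?k powr 1" using k1 by (intro powr_mono) auto
    then have "T \<le> c' * ?k" using c'0 k1 by (simp add: T_def)
    then have "32 * b * T \<le> 32 * b * (c' * ?k)" using b by (intro mult_left_mono) auto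
    also have "\<dots> \<le> 1 * ?k" using mult_right_mono[OF c'b, of ?k] by (simp add: mult.assoc)
    finally have Tk: "32 * b * T \<le> ?k" by simp
    have codim2: "real (card (S \<inter> P)) \<le> T" if "codim2_sphere S" for S
      using contr that unfolding T_def \<beta>_def by force
    define B where "B = 3 * (?n ^ (?d + 1) / ?k powr \<alpha> + ?n / ?k)"
    obtain F where F: "F \<subseteq> rich_hyperspheres k P" "finite F" "B \<le> real (card F)"
    proof (cases "finite (rich_hyperspheres k P)")
      case True
      then show ?thesis using many that[of "rich_hyperspheres k P"] by (simp add: B_def)
    next
      case False
      then obtain F where "F \<subseteq> rich_hyperspheres k P" "finite F" "card F = nat \<lceil>B\<rceil>"
        using infinite_arbitrarily_large by blast
      then show ?thesis using that[of F] by (simp add: of_nat_ceiling)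
    qed
    have "2 \<le> ?d" using assms by simp
    from rich_spheres_bound[OF this F(2) P(1) T0 k1(1) _ F(1) codim2] Tk
    have bound: "real (card F) \<le> (32 * b * C * ?n * T / ?k\<^sup>2) ^ (?d + 1) * (?k / T) + 2 * ?n / ?k"
      unfolding b_def C_def by simp
    have "T ^ ?d = c' ^ ?d * ?k powr (\<beta> * real ?d)"
      using k1 by (simp add: T_def power_mult_distrib powr_power mult.commute)
    also have "\<beta> * real ?d = 2 * real ?d + 1 - \<alpha>" by (simp add: \<beta>_def)
    finally have Td: "T ^ ?d = c' ^ ?d * ?k powr (2 * real ?d + 1 - \<alpha>)" .
    have "(32 * b * C * ?n * T / ?k\<^sup>2) ^ (?d + 1) * (?k / T)
        = E * ?n ^ (?d + 1) * T ^ ?d * (?k / (?k\<^sup>2) ^ (?d + 1))"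
      using T0 by (simp add: E_def power_mult_distrib power_divide)
    also have "?k / (?k\<^sup>2) ^ (?d + 1) = ?k powr (- (2 * real ?d + 1))"
    proof -
      have "(?k\<^sup>2) ^ (?d + 1) = ?k * ?k ^ (2 * ?d + 1)"
        by (simp flip: power_mult power_Suc)
      also have "?k ^ (2 * ?d + 1) = ?k powr (2 * real ?d + 1)"
        using k1 by (subst powr_realpow[symmetric]) (auto simp: add.commute)
      finally have "(?k\<^sup>2) ^ (?d + 1) = ?k * ?k powr (2 * real ?d + 1)" .
      then show ?thesis using k1 by (simp only: powr_minus_divide) simp
    qed
    also have "E * ?n ^ (?d + 1) * T ^ ?d * ?k powr (- (2 * real ?d + 1))
        = E * c' ^ ?d * (?n ^ (?d + 1) * (?k powr (2 * real ?d + 1 - \<alpha>) * ?k powr (- (2 * real ?d + 1))))"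
      by (simp add: Td)
    also have "?k powr (2 * real ?d + 1 - \<alpha>) * ?k powr (- (2 * real ?d + 1)) = 1 / ?k powr \<alpha>"
      by (simp add: powr_add[symmetric] powr_minus_divide)
    also have "E * c' ^ ?d * (?n ^ (?d + 1) * (1 / ?k powr \<alpha>)) \<le> 1 * (?n ^ (?d + 1) * (1 / ?k powr \<alpha>))"
    proof (rule mult_right_mono)
      have "c' ^ ?d \<le> c' ^ 1" using c'0 c'1 assms by (intro power_decreasing) auto
      then have "E * c' ^ ?d \<le> E * c'" using E by (intro mult_left_mono) auto
      then show "E * c' ^ ?d \<le> 1" using c'E by linarith
    qed simp
    finally have "real (card F) \<le> ?n ^ (?d + 1) / ?k powr \<alpha> + 2 * (?n / ?k)" using bound by simp
    moreover have "0 < ?n / ?k" "0 \<le> ?n ^ (?d + 1) / ?k powr \<alpha>" using n0 k1 by auto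
    ultimately show False using F(3) unfolding B_def distrib_left by linarith
  qed
  show ?thesis
  proof (rule exI[of _ "3::real"], intro conjI allI impI exI[of _ c'])
    fix \<alpha> :: real and k :: nat and P :: "'a set"
    assume "real ?d + 1 \<le> \<alpha> \<and> \<alpha> < 2 * real ?d + 1"
      and "?d + 1 \<le> k \<and> finite P \<and> P \<noteq> {} \<and> (infinite (rich_hyperspheres k P) \<or>
        3 * (real (card P) ^ (?d + 1) / real k powr \<alpha> + real (card P) / real k) \<le>
        real (card (rich_hyperspheres k P)))"
    then show "\<exists>S. codim2_sphere S \<and> c' * real k powr ((2 * real ?d + 1 - \<alpha>) / real ?d) \<le> real (card (S \<inter> P))"
      using main[of \<alpha> k P] by blast
  qed (use c'0 in auto)
qed

end
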